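(* Let $G$ be a countable infinite group and let $A\subseteq G$ be non-empty. Then $A$ is of minimal type if and only if $\langle A\rangle$ is a minimal point in the partially ordered set of $\sim$-equivalence classes of non-empty subsets of $G$, ordered by $\precsim$. In other words, $A$ is of minimal type if and only if whenever a non-empty $B\subseteq G$ satisfies $B\precsim A$, then $B\sim A$.
   Context: For non-empty $A,B\subseteq G$ write $A\propto B$ if $A\subseteq FB=\bigcup_{g\in F}gB$ for some finite $F\subseteq G$, and $A\approx B$ if $A\propto B$ and $B\propto A$; $[A]$ is the $\approx$-class of $A$. A sequence $(A_n)$ of subsets of $G$ converges to $B\subseteq G$, written $A_n\to B$, if the indicator functions $1_{A_n}$ converge pointwise to $1_B$. Write $A\succsim B$ (equivalently $B\precsim A$) if there are a sequence $(g_n)$ in $G$ and $B'\subseteq G$ with $Ag_n\to B'$ and $B\approx B'$. This relation is a preorder; $A\sim B$ means $A\succsim B$ and $B\succsim A$, and $\langle A\rangle$ is the $\sim$-class of $A$. A locally compact $G$-space is a locally compact Hausdorff space with an action of the discrete group $G$ by homeomorphisms; it is minimal if non-empty and every orbit is dense, and co-compact if there is a compact $K\subseteq X$ with $\bigcup_{g\in G}g.K=X$ (minimal ones are co-compact). A pointed locally compact $G$-space is a pair $(X,x_0)$ with $x_0\in X$ and $G.x_0$ dense in $X$. Put $\mathcal M(G,X,x_0)=\{B\subseteq G:\overline{B.x_0}\text{ is compact}\}$ and $\mathcal M_A=\{B\subseteq G: B\subseteq FA\text{ for some finite }F\subseteq G\}$. If $X$ is co-compact, there is a non-empty $A\subseteq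 G$, unique up to $\approx$, with $\mathcal M(G,X,x_0)=\mathcal M_A$, and the type is $\mathrm{T}(G,X,x_0)=[A]$. A non-empty $A\subseteq G$ is of minimal type if $\mathrm{T}(G,X,x_0)=[A]$ for some pointed minimal locally compact $G$-space $(X,x_0)$. *)

theory Defs
  imports
    "HOL-Analysis.Analysis"
    "HOL-Algebra.Group_Action"
    "HOL-Library.Diagonal_Subsequence"
begin

section \<open>Relations between subsets of a group\<close>

definition nonempty_subsets :: "('g, 'b) monoid_scheme \<Rightarrow> 'g set set" where
  "nonempty_subsets G = {A. A \<subseteq> carrier G \<and> A \<noteq> {}}"

definition dominated :: "('g, 'b) monoid_scheme \<Rightarrow> 'g set \<Rightarrow> 'g set \<Rightarrow> bool" where
  "dominated G A B \<longleftrightarrow> (\<exists>F. finite F \<and> F \<subseteq> carrier G \<and> A \<subseteq> F <#>\<^bsub>G\<^esub> B)"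

definition approx :: "('g, 'b) monoid_scheme \<Rightarrow> 'g set \<Rightarrow> 'g set \<Rightarrow> bool" where
  "approx G A B \<longleftrightarrow> dominated G A B \<and> dominated G B A"

definition approx_class :: "('g, 'b) monoid_scheme \<Rightarrow> 'g set \<Rightarrow> 'g set set" where
  "approx_class G A = {B \<in> nonempty_subsets G. approx G A B}"

definition set_converges ::
    "('g, 'b) monoid_scheme \<Rightarrow> (nat \<Rightarrow> 'g set) \<Rightarrow> 'g set \<Rightarrow> bool" where
  "set_converges G S B \<longleftrightarrow>
     (\<forall>x\<in>carrier G. (\<lambda>n. indicator (S n) x :: real) \<longlonglongrightarrow> indicator B x)"

definition succsim :: "('g, 'b) monoid_scheme \<Rightarrow> 'g set \<Rightarrow> 'g set \<Rightarrow> bool" where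
  "succsim G A B \<longleftrightarrow>
     (\<exists>(g :: nat \<Rightarrow> 'g) B'. (\<forall>n. g n \<in> carrier G) \<and> B' \<subseteq> carrier G \<and>
        set_converges G (\<lambda>n. A #>\<^bsub>G\<^esub> g n) B' \<and> approx G B B')"

abbreviation precsim :: "('g, 'b) monoid_scheme \<Rightarrow> 'g set \<Rightarrow> 'g set \<Rightarrow> bool" where
  "precsim G B A \<equiv> succsim G A B"

definition sim :: "('g, 'b) monoid_scheme \<Rightarrow> 'g set \<Rightarrow> 'g set \<Rightarrow> bool" where
  "sim G A B \<longleftrightarrow> succsim G A B \<and> succsim G B A"

definition sim_class :: "('g, 'b) monoid_scheme \<Rightarrow> 'g set \<Rightarrow> 'g set set" where
  "sim_class G A = {B \<in> nonempty_subsets G. sim G A B}"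

definition sim_classes :: "('g, 'b) monoid_scheme \<Rightarrow> 'g set set set" where
  "sim_classes G = sim_class G ` nonempty_subsets G"

definition sim_class_order :: "('g, 'b) monoid_scheme \<Rightarrow> ('g set set) rel" where
  "sim_class_order G =
     {(sim_class G B, sim_class G A) | A B.
        A \<in> nonempty_subsets G \<and> B \<in> nonempty_subsets G \<and> precsim G B A}"

definition minimal_point :: "'a set \<Rightarrow> 'a rel \<Rightarrow> 'a \<Rightarrow> bool" where
  "minimal_point P r c \<longleftrightarrow> c \<in> P \<and> (\<forall>d\<in>P. (d, c) \<in> r \<longrightarrow> d = c)"


no_notation eq_closure_of (\<open>closure'_of\<index>\<close>)

section \<open>Locally compact \<open>G\<close>-spaces and their type\<close>

locale lc_gspace = group_action G "topspace X" \<phi>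
  for G :: "('g, 'b) monoid_scheme" (structure)
    and X :: "'x topology" and \<phi> :: "'g \<Rightarrow> 'x \<Rightarrow> 'x" +
  assumes locally_compact: "locally_compact_space X"
    and Hausdorff: "Hausdorff_space X"
    and homeomorphic_action: "g \<in> carrier G \<Longrightarrow> homeomorphic_map X X (\<phi> g)"

locale pointed_lc_gspace = lc_gspace G X \<phi>
  for G :: "('g, 'b) monoid_scheme" (structure)
    and X :: "'x topology" and \<phi> :: "'g \<Rightarrow> 'x \<Rightarrow> 'x" +
  fixes x\<^sub>0 :: 'x
  assumes base_point: "x\<^sub>0 \<in> topspace X"
    and dense_orbit: "X closure_of (orbit G \<phi> x\<^sub>0) = topspace X"

definition minimal_gspace ::
    "('g, 'b) monoid_scheme \<Rightarrow> 'x topology \<Rightarrow> ('g \<Rightarrow> 'x \<Rightarrow> 'x) \<Rightarrow> bool" where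
  "minimal_gspace G X \<phi> \<longleftrightarrow>
     topspace X \<noteq> {} \<and> (\<forall>x\<in>topspace X. X closure_of (orbit G \<phi> x) = topspace X)"

definition cocompact_gspace ::
    "('g, 'b) monoid_scheme \<Rightarrow> 'x topology \<Rightarrow> ('g \<Rightarrow> 'x \<Rightarrow> 'x) \<Rightarrow> bool" where
  "cocompact_gspace G X \<phi> \<longleftrightarrow>
     (\<exists>K. compactin X K \<and> (\<Union>g\<in>carrier G. \<phi> g ` K) = topspace X)"

definition rel_compact_sets ::
    "('g, 'b) monoid_scheme \<Rightarrow> 'x topology \<Rightarrow> ('g \<Rightarrow> 'x \<Rightarrow> 'x) \<Rightarrow> 'x \<Rightarrow> 'g set set" where
  "rel_compact_sets G X \<phi> x\<^sub>0 =
     {B. B \<subseteq> carrier G \<and> compactin X (X closure_of ((\<lambda>g. \<phi> g x\<^sub>0) ` B))}"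

definition dominated_sets :: "('g, 'b) monoid_scheme \<Rightarrow> 'g set \<Rightarrow> 'g set set" where
  "dominated_sets G A = {B. B \<subseteq> carrier G \<and> dominated G B A}"

text \<open>The description is well-defined for every co-compact space:
  see \<open>gspace_type_ex1\<close> below.\<close>

definition gspace_type ::
    "('g, 'b) monoid_scheme \<Rightarrow> 'x topology \<Rightarrow> ('g \<Rightarrow> 'x \<Rightarrow> 'x) \<Rightarrow> 'x \<Rightarrow> 'g set set" where
  "gspace_type G X \<phi> x\<^sub>0 =
     (THE C. \<exists>A\<in>nonempty_subsets G.
        rel_compact_sets G X \<phi> x\<^sub>0 = dominated_sets G A \<and> C = approx_class G A)"

text \<open>HOL cannot quantify over all types, so the space is required to live on the fixed type
  \<^typ>\<open>'g set set\<close>. This is no restriction: a Hausdorff space with a dense orbit has at most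
  \<open>2^(2^|G|)\<close> points, and \<open>of_minimal_typeI\<close> below shows that
  a witness over an arbitrary type is enough.\<close>

definition of_minimal_type :: "('g, 'b) monoid_scheme \<Rightarrow> 'g set \<Rightarrow> bool" where
  "of_minimal_type G A \<longleftrightarrow>
     A \<in> nonempty_subsets G \<and>
     (\<exists>(X :: 'g set set topology) \<phi> x\<^sub>0.
        pointed_lc_gspace G X \<phi> x\<^sub>0 \<and> minimal_gspace G X \<phi> \<and>
        gspace_type G X \<phi> x\<^sub>0 = approx_class G A)"


section \<open>The \<open>\<sim>\<close>-classes form a partially ordered set\<close>

lemma set_converges_iff:
  "set_converges G S B \<longleftrightarrow>
     (\<forall>x\<in>carrier G. \<forall>\<^sub>F n in sequentially. x \<in> S n \<longleftrightarrow> x \<in> B)"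
proof -
  have "(\<lambda>n. indicator (S n) x :: real) \<longlonglongrightarrow> indicator B x \<longleftrightarrow>
        (\<forall>\<^sub>F n in sequentially. x \<in> S n \<longleftrightarrow> x \<in> B)" for x
  proof
    assume "(\<lambda>n. indicator (S n) x :: real) \<longlonglongrightarrow> indicator B x"
    then have "\<forall>\<^sub>F n in sequentially. dist (indicator (S n) x :: real) (indicator B x) < 1"
      by (rule tendstoD) simp
    then show "\<forall>\<^sub>F n in sequentially. x \<in> S n \<longleftrightarrow> x \<in> B"
      by (rule eventually_mono) (auto simp: indicator_def dist_real_def split: if_splits)
  next
    assume "\<forall>\<^sub>F n in sequentially. x \<in> S n \<longleftrightarrow> x \<in> B"
    then have "\<forall>\<^sub>F n in sequentially. (indicator (S n) x :: real) = indicator B x"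
      by (rule eventually_mono) (auto simp: indicator_def)
    then show "(\<lambda>n. indicator (S n) x :: real) \<longlonglongrightarrow> indicator B x"
      by (rule tendsto_eventually)
  qed
  then show ?thesis by (simp add: set_converges_def)
qed

lemma set_converges_subsequence:
  fixes S :: "nat \<Rightarrow> 'g set"
  assumes "countable (carrier G)"
  obtains r B where "strict_mono (r :: nat \<Rightarrow> nat)" "B \<subseteq> carrier G"
    "set_converges G (S \<circ> r) B"
proof -
  define e where "e = from_nat_into (carrier G)"
  define P where "P = (\<lambda>i (s :: nat \<Rightarrow> nat).
    (\<forall>k. e i \<in> S (s k)) \<or> (\<forall>k. e i \<notin> S (s k)))"
  have ex: "\<exists>r'. strict_mono r' \<and> P i (s \<circ> r')" for i and s :: "nat \<Rightarrow> nat"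
  proof -
    let ?I = "{k. e i \<in> S (s k)}"
    consider "infinite ?I" | "infinite (- ?I)"
      by (metis finite_compl infinite_UNIV_nat)
    then show ?thesis
    proof cases
      case 1
      have "P i (s \<circ> enumerate ?I)"
        using enumerate_in_set[OF 1] by (simp add: P_def)
      then show ?thesis using strict_mono_enumerate[OF 1] by blast
    next
      case 2
      have "P i (s \<circ> enumerate (- ?I))"
        using enumerate_in_set[OF 2] by (simp add: P_def)
      then show ?thesis using strict_mono_enumerate[OF 2] by blast
    qed
  qed
  interpret subseqs P by unfold_locales (rule ex)
  have diag: "P i (diagseq \<circ> (+) (Suc i))" for i
    by (rule diagseq_holds) (auto simp: P_def)
  define B where "B = {x \<in> carrier G. \<forall>\<^sub>F n in sequentially. x \<in> S (diagseq n)}"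
  have "\<forall>\<^sub>F n in sequentially. x \<in> S (diagseq n) \<longleftrightarrow> x \<in> B" if x: "x \<in> carrier G" for x
  proof -
    obtain i where i: "x = e i"
      using x assms unfolding e_def by (metis from_nat_into_surj)
    have sh: "\<forall>n\<ge>Suc i. Q n" if "\<forall>k. Q (Suc i + k)" for Q :: "nat \<Rightarrow> bool"
      using that le_Suc_ex by blast
    have "(\<forall>k. x \<in> S (diagseq (Suc i + k))) \<or> (\<forall>k. x \<notin> S (diagseq (Suc i + k)))"
      using diag[of i] by (simp add: P_def i)
    then consider "\<forall>n\<ge>Suc i. x \<in> S (diagseq n)" | "\<forall>n\<ge>Suc i. x \<notin> S (diagseq n)"
      using sh[of "\<lambda>n. x \<in> S (diagseq n)"] sh[of "\<lambda>n. x \<notin> S (diagseq n)"] by blast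
    then show ?thesis
    proof cases
      case 1
      then have ev: "\<forall>\<^sub>F n in sequentially. x \<in> S (diagseq n)"
        using eventually_sequentially by blast
      then have "x \<in> B" using x by (simp add: B_def)
      with ev show ?thesis by simp
    next
      case 2
      then have ev: "\<forall>\<^sub>F n in sequentially. x \<notin> S (diagseq n)"
        using eventually_sequentially by blast
      have "x \<notin> B"
      proof
        assume "x \<in> B"
        then have "\<forall>\<^sub>F n in sequentially. x \<in> S (diagseq n)" by (simp add: B_def)
        with ev have "\<forall>\<^sub>F n in sequentially. False" by eventually_elim simp
        then show False by simp
      qed
      with ev show ?thesis by simp
    qed
  qed
  then have "set_converges G (S \<circ> diagseq) B"
    by (simp add: set_converges_iff)
  moreover have "B \<subseteq> carrier G" by (auto simp: B_def)
  ultimately show thesis using subseq_diagseq that by blast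
qed

context group
begin

lemma dominated_refl: "A \<subseteq> carrier G \<Longrightarrow> dominated G A A"
  unfolding dominated_def set_mult_def
  by (rule exI[of _ "{\<one>}"]) (auto, metis l_one subsetD)

lemma dominated_trans:
  assumes "dominated G A B" "dominated G B C" "C \<subseteq> carrier G"
  shows "dominated G A C"
proof -
  obtain F where F: "finite F" "F \<subseteq> carrier G" "A \<subseteq> F <#> B"
    using assms unfolding dominated_def by blast
  obtain F' where F': "finite F'" "F' \<subseteq> carrier G" "B \<subseteq> F' <#> C"
    using assms unfolding dominated_def by blast
  have "A \<subseteq> F <#> (F' <#> C)"
    using F(3) F'(3) mono_set_mult by blast
  also have "\<dots> = (F <#> F') <#> C"
    using F F' assms by (simp add: set_mult_assoc)
  finally have "A \<subseteq> (F <#> F') <#> C" .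
  moreover have "finite (F <#> F')" "F <#> F' \<subseteq> carrier G"
    using F F' by (auto simp: set_mult_def)
  ultimately show ?thesis unfolding dominated_def by blast
qed

lemma approx_refl: "A \<subseteq> carrier G \<Longrightarrow> approx G A A"
  by (simp add: approx_def dominated_refl)

lemma approx_sym: "approx G A B \<Longrightarrow> approx G B A"
  by (simp add: approx_def)

lemma approx_trans:
  "approx G A B \<Longrightarrow> approx G B C \<Longrightarrow> A \<subseteq> carrier G \<Longrightarrow> C \<subseteq> carrier G \<Longrightarrow> approx G A C"
  unfolding approx_def using dominated_trans by blast

lemma approx_class_eq_iff:
  assumes "A \<in> nonempty_subsets G" "B \<in> nonempty_subsets G"
  shows "approx_class G A = approx_class G B \<longleftrightarrow> approx G A B"
proof
  assume "approx_class G A = approx_class G B"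
  then show "approx G A B"
    using assms approx_refl[of B] by (auto simp: approx_class_def nonempty_subsets_def)
next
  assume "approx G A B"
  then show "approx_class G A = approx_class G B"
    using assms approx_trans approx_sym
    unfolding approx_class_def nonempty_subsets_def by blast
qed

lemma dominated_limit:
  assumes S: "set_converges G S B" and T: "set_converges G T C"
    and F: "finite F" "F \<subseteq> carrier G"
    and ST: "\<And>n. S n \<subseteq> F <#> T n" and TG: "\<And>n. T n \<subseteq> carrier G"
    and B: "B \<subseteq> carrier G"
  shows "dominated G B C"
proof -
  have "B \<subseteq> F <#> C"
  proof
    fix x assume x: "x \<in> B"
    have ev1: "\<forall>\<^sub>F n in sequentially. \<forall>f\<in>F. inv f \<otimes> x \<in> T n \<longleftrightarrow> inv f \<otimes> x \<in> C"
      using T F x B by (intro eventually_ball_finite) (auto simp: set_converges_iff)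
    have ev2: "\<forall>\<^sub>F n in sequentially. x \<in> S n \<longleftrightarrow> x \<in> B"
      using S x B unfolding set_converges_iff by blast
    from ev1 ev2 have "\<forall>\<^sub>F n in sequentially. \<exists>f\<in>F. inv f \<otimes> x \<in> C"
    proof eventually_elim
      case (elim n)
      then have "x \<in> F <#> T n" using ST x by blast
      then obtain f t where ft: "f \<in> F" "t \<in> T n" "x = f \<otimes> t"
        unfolding set_mult_def by blast
      then have "inv f \<otimes> x = t"
        using F TG[of n] by (metis inv_solve_left m_closed subsetD)
      with ft elim show ?case by metis
    qed
    then obtain f where f: "f \<in> F" "inv f \<otimes> x \<in> C" by auto
    then have "x = f \<otimes> (inv f \<otimes> x)"
      using F x B by (metis inv_solve_left inv_closed m_closed subsetD)
    then show "x \<in> F <#> C" unfolding set_mult_def using f by blast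
  qed
  then show ?thesis using F unfolding dominated_def by blast
qed

lemma dominated_limit_r_coset:
  assumes "dominated G A B" "A \<subseteq> carrier G" "B \<subseteq> carrier G" "\<And>n. h n \<in> carrier G"
    and A': "set_converges G (\<lambda>n. A #> h n) A'" "A' \<subseteq> carrier G"
    and B': "set_converges G (\<lambda>n. B #> h n) B'"
  shows "dominated G A' B'"
proof -
  obtain F where F: "finite F" "F \<subseteq> carrier G" "A \<subseteq> F <#> B"
    using assms unfolding dominated_def by blast
  have "A #> h n \<subseteq> F <#> (B #> h n)" for n
    unfolding r_coset_eq_set_mult
    using F assms by (simp add: set_mult_assoc[symmetric] mono_set_mult)
  then show ?thesis
    using dominated_limit[OF A'(1) B' F(1,2)] assms r_coset_subset_G by blast
qed

lemma mem_r_coset_iff: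
  assumes "A \<subseteq> carrier G" "g \<in> carrier G" "x \<in> carrier G"
  shows "x \<in> A #> g \<longleftrightarrow> x \<otimes> inv g \<in> A"
proof
  assume "x \<in> A #> g"
  then obtain a where "a \<in> A" "x = a \<otimes> g" unfolding r_coset_def by blast
  then show "x \<otimes> inv g \<in> A" using assms by (metis inv_solve_right subsetD)
next
  assume "x \<otimes> inv g \<in> A"
  moreover have "x = (x \<otimes> inv g) \<otimes> g" using assms by (simp add: m_assoc)
  ultimately show "x \<in> A #> g" unfolding r_coset_def by blast
qed

lemma succsim_refl: "A \<subseteq> carrier G \<Longrightarrow> succsim G A A"
  unfolding succsim_def
  by (rule exI[of _ "\<lambda>_. \<one>"], rule exI[of _ A])
     (simp add: coset_mult_one set_converges_def approx_refl)

lemma succsim_trans: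
  assumes count: "countable (carrier G)"
    and sub: "A \<subseteq> carrier G" "B \<subseteq> carrier G" "C \<subseteq> carrier G"
    and AB: "succsim G A B" and BC: "succsim G B C"
  shows "succsim G A C"
proof -
  obtain g B' where g: "\<And>n. g n \<in> carrier G" and B': "B' \<subseteq> carrier G"
    and gB: "set_converges G (\<lambda>n. A #> g n) B'" and BB: "approx G B B'"
    using AB unfolding succsim_def by blast
  obtain h C' where h: "\<And>n. h n \<in> carrier G" and C': "C' \<subseteq> carrier G"
    and hC: "set_converges G (\<lambda>n. B #> h n) C'" and CC: "approx G C C'"
    using BC unfolding succsim_def by blast
  obtain r C'' where r: "strict_mono r" and C'': "C'' \<subseteq> carrier G"
    and rC: "set_converges G ((\<lambda>n. B' #> h n) \<circ> r) C''"
    using set_converges_subsequence[OF count] by blast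
  have rC: "set_converges G (\<lambda>n. B' #> h (r n)) C''" using rC by (simp add: o_def)
  have rC': "set_converges G (\<lambda>n. B #> h (r n)) C'"
    using hC r unfolding set_converges_iff
    by (auto intro: eventually_compose_filterlim filterlim_subseq)
  have "approx G C' C''"
    using BB B' C' C'' sub h
      dominated_limit_r_coset[OF _ _ _ _ rC' _ rC] dominated_limit_r_coset[OF _ _ _ _ rC _ rC']
    unfolding approx_def by blast
  then have CC'': "approx G C C''" using approx_trans CC sub C'' by blast
  define e where "e = from_nat_into (carrier G)"
  have e: "e i \<in> carrier G" for i
    unfolding e_def using from_nat_into one_closed by (metis emptyE)
  have "\<exists>k. k \<in> carrier G \<and> (\<forall>i\<le>N. e i \<in> A #> k \<longleftrightarrow> e i \<in> C'')" for N
  proof -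
    have "\<forall>\<^sub>F m in sequentially. \<forall>i\<in>{..N}. e i \<in> B' #> h (r m) \<longleftrightarrow> e i \<in> C''"
      using rC e by (intro eventually_ball_finite) (auto simp: set_converges_iff)
    then obtain m where m: "\<And>i. i \<le> N \<Longrightarrow> e i \<in> B' #> h (r m) \<longleftrightarrow> e i \<in> C''"
      unfolding eventually_sequentially by auto
    have "\<forall>\<^sub>F n in sequentially. \<forall>i\<in>{..N}.
        e i \<otimes> inv (h (r m)) \<in> A #> g n \<longleftrightarrow> e i \<otimes> inv (h (r m)) \<in> B'"
      using gB e h by (intro eventually_ball_finite) (auto simp: set_converges_iff)
    then obtain n where n: "\<And>i. i \<le> N \<Longrightarrow>
        e i \<otimes> inv (h (r m)) \<in> A #> g n \<longleftrightarrow> e i \<otimes> inv (h (r m)) \<in> B'"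
      unfolding eventually_sequentially by auto
    have "A #> (g n \<otimes> h (r m)) = (A #> g n) #> h (r m)"
      using sub g h by (simp add: coset_mult_assoc)
    then have "e i \<in> A #> (g n \<otimes> h (r m)) \<longleftrightarrow> e i \<in> C''" if "i \<le> N" for i
      using mem_r_coset_iff[of "A #> g n" "h (r m)" "e i"] mem_r_coset_iff[of B' "h (r m)" "e i"]
        m[OF that] n[OF that] sub B' g h e r_coset_subset_G by simp
    then show ?thesis using g h by blast
  qed
  then obtain k where k: "\<And>N. k N \<in> carrier G"
    "\<And>N i. i \<le> N \<Longrightarrow> e i \<in> A #> k N \<longleftrightarrow> e i \<in> C''"
    by metis
  have "\<forall>\<^sub>F n in sequentially. x \<in> A #> k n \<longleftrightarrow> x \<in> C''" if x: "x \<in> carrier G" for x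
  proof -
    obtain i where i: "x = e i"
      using from_nat_into_surj[OF count x] unfolding e_def by metis
    show ?thesis unfolding i eventually_sequentially using k(2) by blast
  qed
  then have "set_converges G (\<lambda>n. A #> k n) C''" by (simp add: set_converges_iff)
  then show ?thesis unfolding succsim_def using k(1) C'' CC'' by blast
qed

lemma sim_sym: "sim G A B \<Longrightarrow> sim G B A"
  by (simp add: sim_def)

lemma sim_trans:
  assumes "countable (carrier G)"
    and "A \<in> nonempty_subsets G" "B \<in> nonempty_subsets G" "C \<in> nonempty_subsets G"
    and "sim G A B" "sim G B C"
  shows "sim G A C"
  using assms succsim_trans[OF assms(1), of A B C] succsim_trans[OF assms(1), of C B A]
  by (simp add: sim_def nonempty_subsets_def)

lemma sim_class_eq_iff:
  assumes "countable (carrier G)" "A \<in> nonempty_subsets G" "B \<in> nonempty_subsets G"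
  shows "sim_class G A = sim_class G B \<longleftrightarrow> sim G A B"
proof
  assume "sim_class G A = sim_class G B"
  then show "sim G A B"
    using assms succsim_refl[of B] by (auto simp: sim_class_def sim_def nonempty_subsets_def)
next
  assume "sim G A B"
  then show "sim_class G A = sim_class G B"
    using sim_trans[OF assms(1)] sim_sym assms(2,3) unfolding sim_class_def by blast
qed

lemma sim_class_order_iff:
  assumes "countable (carrier G)" "A \<in> nonempty_subsets G" "B \<in> nonempty_subsets G"
  shows "(sim_class G B, sim_class G A) \<in> sim_class_order G \<longleftrightarrow> precsim G B A"
proof
  assume "(sim_class G B, sim_class G A) \<in> sim_class_order G"
  then obtain A' B' where *: "A' \<in> nonempty_subsets G" "B' \<in> nonempty_subsets G"
    "sim_class G B = sim_class G B'" "sim_class G A = sim_class G A'" "precsim G B' A'"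
    unfolding sim_class_order_def by blast
  then have "sim G B B'" "sim G A A'" using sim_class_eq_iff assms by blast+
  then have "succsim G A A'" "succsim G A' B'" "succsim G B' B"
    using *(5) by (simp_all add: sim_def)
  then show "precsim G B A"
    using *(1,2) assms(2,3) succsim_trans[OF assms(1), of A A' B']
      succsim_trans[OF assms(1), of A B' B] by (simp add: nonempty_subsets_def)
next
  assume "precsim G B A"
  then show "(sim_class G B, sim_class G A) \<in> sim_class_order G"
    using assms unfolding sim_class_order_def by blast
qed

lemma partial_order_sim_class_order:
  assumes "countable (carrier G)"
  shows "partial_order_on (sim_classes G) (sim_class_order G)"
  unfolding partial_order_on_def preorder_on_def
proof (intro conjI)
  show "sim_class_order G \<subseteq> sim_classes G \<times> sim_classes G"
    by (auto simp: sim_class_order_def sim_classes_def)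
  show "refl_on (sim_classes G) (sim_class_order G)"
    using sim_class_order_iff[OF assms] succsim_refl
    by (auto simp: refl_on_def sim_classes_def nonempty_subsets_def)
  show "trans (sim_class_order G)"
  proof (rule transI)
    fix x y z assume xy: "(x, y) \<in> sim_class_order G" and yz: "(y, z) \<in> sim_class_order G"
    obtain A B where AB: "x = sim_class G A" "y = sim_class G B"
      "A \<in> nonempty_subsets G" "B \<in> nonempty_subsets G"
      using xy unfolding sim_class_order_def by blast
    obtain C where C: "z = sim_class G C" "C \<in> nonempty_subsets G"
      using yz unfolding sim_class_order_def by blast
    have "succsim G B A" "succsim G C B"
      using xy yz AB C sim_class_order_iff[OF assms] by auto
    then have "succsim G C A"
      using succsim_trans[OF assms, of C B A] AB C by (auto simp: nonempty_subsets_def)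
    then show "(x, z) \<in> sim_class_order G"
      using AB C sim_class_order_iff[OF assms] by simp
  qed
  show "antisym (sim_class_order G)"
  proof (rule antisymI)
    fix x y assume xy: "(x, y) \<in> sim_class_order G" and yx: "(y, x) \<in> sim_class_order G"
    obtain A B where AB: "x = sim_class G A" "y = sim_class G B"
      "A \<in> nonempty_subsets G" "B \<in> nonempty_subsets G"
      using xy unfolding sim_class_order_def by blast
    then have "sim G A B"
      using xy yx sim_class_order_iff[OF assms] by (auto simp: sim_def)
    then show "x = y" using AB sim_class_eq_iff[OF assms] by simp
  qed
qed

lemma dominated_sets_eq_iff:
  assumes "A \<in> nonempty_subsets G" "B \<in> nonempty_subsets G"
  shows "dominated_sets G A = dominated_sets G B \<longleftrightarrow> approx G A B"
proof
  assume *: "dominated_sets G A = dominated_sets G B"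
  have "A \<in> dominated_sets G A" "B \<in> dominated_sets G B"
    using assms dominated_refl by (auto simp: dominated_sets_def nonempty_subsets_def)
  then show "approx G A B" using * by (auto simp: approx_def dominated_sets_def)
next
  assume "approx G A B"
  then show "dominated_sets G A = dominated_sets G B"
    using assms dominated_trans unfolding approx_def dominated_sets_def nonempty_subsets_def
    by blast
qed

end


section \<open>The type is well-defined\<close>

lemma (in lc_gspace) is_group: "group G"
  using group_hom group_hom.axioms(1) by blast

lemma (in lc_gspace) minimal_imp_cocompact:
  assumes "minimal_gspace G X \<phi>"
  shows "cocompact_gspace G X \<phi>"
proof -
  obtain x where x: "x \<in> topspace X" using assms unfolding minimal_gspace_def by blast
  obtain U K where UK: "openin X U" "compactin X K" "x \<in> U" "U \<subseteq> K"
    using locally_compact x unfolding locally_compact_space_def by blast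
  have "y \<in> (\<Union>g\<in>carrier G. \<phi> g ` K)" if y: "y \<in> topspace X" for y
  proof -
    have "orbit G \<phi> y \<inter> U \<noteq> {}"
      using assms y UK unfolding minimal_gspace_def dense_intersects_open by blast
    then obtain g where g: "g \<in> carrier G" "\<phi> g y \<in> U" by (auto simp: orbit_def)
    then have "\<phi> (inv g) (\<phi> g y) = y" using orbit_sym_aux y by blast
    then have "y \<in> \<phi> (inv g) ` K" using g UK by force
    then show ?thesis using g is_group by (meson UN_I group.inv_closed)
  qed
  moreover have "\<phi> g ` K \<subseteq> topspace X" if "g \<in> carrier G" for g
    using surj_prop[OF that] compactin_subset_topspace[OF UK(2)] by blast
  ultimately show ?thesis
    using UK unfolding cocompact_gspace_def by blast
qed

lemma (in pointed_lc_gspace) rel_compact_sets_eq_dominated_sets: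
  assumes "cocompact_gspace G X \<phi>"
  obtains A where "A \<in> nonempty_subsets G"
    "rel_compact_sets G X \<phi> x\<^sub>0 = dominated_sets G A"
proof -
  interpret group G by (rule is_group)
  obtain K where K: "compactin X K" "(\<Union>g\<in>carrier G. \<phi> g ` K) = topspace X"
    using assms unfolding cocompact_gspace_def by blast
  obtain U L where UL: "openin X U" "compactin X L" "K \<subseteq> U" "U \<subseteq> L"
    using locally_compact Hausdorff K locally_compact_space_compact_closed_compact[of X] by blast
  have UX: "U \<subseteq> topspace X" using UL openin_subset by blast
  define A where "A = {g \<in> carrier G. \<phi> g x\<^sub>0 \<in> U}"
  have "U \<noteq> {}" using K UL base_point by blast
  then have "orbit G \<phi> x\<^sub>0 \<inter> U \<noteq> {}"
    using dense_orbit UL unfolding dense_intersects_open by blast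
  then have A: "A \<in> nonempty_subsets G"
    by (auto simp: A_def nonempty_subsets_def orbit_def)
  have X0: "\<phi> g x\<^sub>0 \<in> topspace X" if "g \<in> carrier G" for g
    using element_image that base_point by blast
  have "B \<in> dominated_sets G A" if "B \<in> rel_compact_sets G X \<phi> x\<^sub>0" for B
  proof -
    let ?C = "X closure_of ((\<lambda>g. \<phi> g x\<^sub>0) ` B)"
    have B: "B \<subseteq> carrier G" and C: "compactin X ?C"
      using that by (auto simp: rel_compact_sets_def)
    have op: "openin X (\<phi> g ` U)" if "g \<in> carrier G" for g
      using homeomorphic_action[OF that] UL UX homeomorphic_map_openness by blast
    have "(\<Union>g\<in>carrier G. \<phi> g ` K) \<subseteq> (\<Union>g\<in>carrier G. \<phi> g ` U)"
      using UL(3) by (intro UN_mono image_mono) auto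
    then have cover: "?C \<subseteq> \<Union>((\<lambda>g. \<phi> g ` U) ` carrier G)"
      using K(2) closure_of_subset_topspace[of X "(\<lambda>g. \<phi> g x\<^sub>0) ` B"] by simp
    then obtain \<F> where \<F>: "finite \<F>" "\<F> \<subseteq> (\<lambda>g. \<phi> g ` U) ` carrier G" "?C \<subseteq> \<Union>\<F>"
      using compactinD[OF C _ cover] op by blast
    obtain F where F: "finite F" "F \<subseteq> carrier G" "\<F> = (\<lambda>g. \<phi> g ` U) ` F"
      using finite_subset_image[OF \<F>(1,2)] by blast
    have "B \<subseteq> F <#> A"
    proof
      fix b assume b: "b \<in> B"
      then have "\<phi> b x\<^sub>0 \<in> ?C"
        using closure_of_subset[of "(\<lambda>g. \<phi> g x\<^sub>0) ` B" X] X0 B by blast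
      then obtain f u where f: "f \<in> F" "u \<in> U" "\<phi> b x\<^sub>0 = \<phi> f u"
        using \<F>(3) F(3) by auto
      have fb: "f \<in> carrier G" "b \<in> carrier G" using f F b B by auto
      have "\<phi> (inv f \<otimes> b) x\<^sub>0 = \<phi> (inv f) (\<phi> f u)"
        using composition_rule fb base_point f by simp
      also have "\<dots> = u" using orbit_sym_aux fb f UX by blast
      finally have "inv f \<otimes> b \<in> A" using f fb by (simp add: A_def)
      moreover have "b = f \<otimes> (inv f \<otimes> b)" using fb by (simp add: m_assoc[symmetric])
      ultimately show "b \<in> F <#> A" using f unfolding set_mult_def by blast
    qed
    then show ?thesis using B F unfolding dominated_sets_def dominated_def by blast
  qed
  moreover have "B \<in> rel_compact_sets G X \<phi> x\<^sub>0" if BA: "B \<in> dominated_sets G A" for B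
  proof -
    obtain F where B: "B \<subseteq> carrier G" and F: "finite F" "F \<subseteq> carrier G" "B \<subseteq> F <#> A"
      using BA unfolding dominated_sets_def dominated_def by blast
    let ?L = "\<Union>((\<lambda>f. \<phi> f ` L) ` F)"
    have "compactin X (\<phi> f ` L)" if "f \<in> F" for f
      using homeomorphic_action[of f] that F UL image_compactin homeomorphic_imp_continuous_map
      by blast
    then have L: "compactin X ?L" using F by (intro compactin_Union) auto
    have "(\<lambda>g. \<phi> g x\<^sub>0) ` B \<subseteq> ?L"
    proof clarify
      fix b assume "b \<in> B"
      then obtain f a where fa: "f \<in> F" "a \<in> A" "b = f \<otimes> a"
        using F unfolding set_mult_def by blast
      have "\<phi> b x\<^sub>0 = \<phi> f (\<phi> a x\<^sub>0)"
        using fa F composition_rule base_point by (auto simp: A_def)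
      moreover have "\<phi> a x\<^sub>0 \<in> L" using fa UL by (auto simp: A_def)
      ultimately show "\<phi> b x\<^sub>0 \<in> ?L" using fa by blast
    qed
    then have "X closure_of ((\<lambda>g. \<phi> g x\<^sub>0) ` B) \<subseteq> ?L"
      by (rule closure_of_minimal) (rule compactin_imp_closedin[OF Hausdorff L])
    from closed_compactin[OF L this closedin_closure_of] show ?thesis
      using B by (simp add: rel_compact_sets_def)
  qed
  ultimately show thesis using A that by blast
qed

lemma (in pointed_lc_gspace) gspace_type_ex1:
  assumes "cocompact_gspace G X \<phi>"
  shows "\<exists>!C. \<exists>A\<in>nonempty_subsets G.
    rel_compact_sets G X \<phi> x\<^sub>0 = dominated_sets G A \<and> C = approx_class G A"
proof -
  interpret group G by (rule is_group)
  show ?thesis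
    using rel_compact_sets_eq_dominated_sets[OF assms] dominated_sets_eq_iff approx_class_eq_iff
    by metis
qed

lemma (in pointed_lc_gspace) gspace_type_eq_iff:
  assumes "cocompact_gspace G X \<phi>" and A: "A \<in> nonempty_subsets G"
  shows "gspace_type G X \<phi> x\<^sub>0 = approx_class G A \<longleftrightarrow>
    rel_compact_sets G X \<phi> x\<^sub>0 = dominated_sets G A"
proof -
  interpret group G by (rule is_group)
  obtain B where B: "B \<in> nonempty_subsets G"
    "rel_compact_sets G X \<phi> x\<^sub>0 = dominated_sets G B"
    using rel_compact_sets_eq_dominated_sets[OF assms(1)] by blast
  then have "gspace_type G X \<phi> x\<^sub>0 = approx_class G B"
    unfolding gspace_type_def by (intro the1_equality gspace_type_ex1 assms) auto
  then show ?thesis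
    using A B approx_class_eq_iff[OF B(1) A] dominated_sets_eq_iff[OF B(1) A] by simp
qed


section \<open>Independence of the carrier type of the space\<close>

lemma (in pointed_lc_gspace) transfer:
  fixes Y :: "'y topology" and f :: "'x \<Rightarrow> 'y"
  assumes maps: "homeomorphic_maps X Y f h"
  defines "\<psi> \<equiv> \<lambda>g. \<lambda>y\<in>topspace Y. f (\<phi> g (h y))"
  shows "pointed_lc_gspace G Y \<psi> (f x\<^sub>0)"
    and "minimal_gspace G X \<phi> \<Longrightarrow> minimal_gspace G Y \<psi>"
    and "rel_compact_sets G Y \<psi> (f x\<^sub>0) = rel_compact_sets G X \<phi> x\<^sub>0"
    and "gspace_type G Y \<psi> (f x\<^sub>0) = gspace_type G X \<phi> x\<^sub>0"
proof -
  interpret group G by (rule is_group)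
  have f: "homeomorphic_map X Y f" and h: "homeomorphic_map Y X h"
    and hf: "\<And>x. x \<in> topspace X \<Longrightarrow> h (f x) = x"
    and fh: "\<And>y. y \<in> topspace Y \<Longrightarrow> f (h y) = y"
    using maps by (auto simp: homeomorphic_maps_map)
  have fX: "\<And>x. x \<in> topspace X \<Longrightarrow> f x \<in> topspace Y"
    and hY: "\<And>y. y \<in> topspace Y \<Longrightarrow> h y \<in> topspace X"
    using homeomorphic_imp_surjective_map f h by blast+
  have \<phi>X: "\<phi> g x \<in> topspace X" if "g \<in> carrier G" "x \<in> topspace X" for g x
    using element_image that by blast
  have \<psi>: "\<psi> g (f x) = f (\<phi> g x)" if "x \<in> topspace X" for g x
    using that by (simp add: \<psi>_def hf fX)
  have hom\<psi>: "homeomorphic_map Y Y (\<psi> g)" if "g \<in> carrier G" for g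
  proof -
    have "homeomorphic_map Y Y (f \<circ> (\<phi> g \<circ> h))"
      using homeomorphic_map_compose[OF homeomorphic_map_compose[OF h homeomorphic_action[OF that]] f]
      .
    then show ?thesis by (rule homeomorphic_map_eq) (simp add: \<psi>_def)
  qed
  have Bij\<psi>: "\<psi> g \<in> Bij (topspace Y)" if "g \<in> carrier G" for g
    using hom\<psi>[OF that] homeomorphic_imp_surjective_map homeomorphic_imp_injective_map
    by (fastforce simp: Bij_def bij_betw_def \<psi>_def)
  have act: "group_action G (topspace Y) \<psi>"
  proof (intro group_action.intro group_hom.intro group_hom_axioms.intro homI
      is_group group_BijGroup)
    show "\<psi> g \<in> carrier (BijGroup (topspace Y))" if "g \<in> carrier G" for g
      using Bij\<psi>[OF that] by (simp add: BijGroup_def)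
    show "\<psi> (g \<otimes> k) = \<psi> g \<otimes>\<^bsub>BijGroup (topspace Y)\<^esub> \<psi> k"
      if gk: "g \<in> carrier G" "k \<in> carrier G" for g k
    proof -
      have "\<psi> (g \<otimes> k) = compose (topspace Y) (\<psi> g) (\<psi> k)"
        unfolding compose_def \<psi>_def
        by (rule restrict_ext) (simp add: gk hY fX hf \<phi>X composition_rule)
      then show ?thesis using gk Bij\<psi> by (simp add: BijGroup_def)
    qed
  qed
  have orb: "orbit G \<psi> (f x) = f ` orbit G \<phi> x" if "x \<in> topspace X" for x
    using \<psi>[OF that] by (auto simp: orbit_def)
  have orbX: "orbit G \<phi> x \<subseteq> topspace X" if "x \<in> topspace X" for x
    using \<phi>X that by (auto simp: orbit_def)
  have dense: "Y closure_of orbit G \<psi> (f x) = topspace Y"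
    if "x \<in> topspace X" "X closure_of orbit G \<phi> x = topspace X" for x
    using that orb orbX homeomorphic_map_closure_of[OF f] homeomorphic_imp_surjective_map[OF f]
    by simp
  have homeo: "X homeomorphic_space Y" using maps homeomorphic_space_def by blast
  show pointed: "pointed_lc_gspace G Y \<psi> (f x\<^sub>0)"
    unfolding pointed_lc_gspace_def lc_gspace_def lc_gspace_axioms_def
      pointed_lc_gspace_axioms_def
    using act hom\<psi> homeomorphic_locally_compact_space[OF homeo]
      homeomorphic_Hausdorff_space[OF homeo] locally_compact Hausdorff fX[OF base_point]
      dense[OF base_point dense_orbit]
    by (intro conjI) auto
  show "minimal_gspace G Y \<psi>" if "minimal_gspace G X \<phi>"
    unfolding minimal_gspace_def
  proof (intro conjI ballI)
    show "topspace Y \<noteq> {}" using fX base_point by blast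
    show "Y closure_of orbit G \<psi> y = topspace Y" if "y \<in> topspace Y" for y
      using dense[of "h y"] that hY fh \<open>minimal_gspace G X \<phi>\<close>
      by (auto simp: minimal_gspace_def)
  qed
  show rc: "rel_compact_sets G Y \<psi> (f x\<^sub>0) = rel_compact_sets G X \<phi> x\<^sub>0"
  proof -
    have "compactin Y (Y closure_of ((\<lambda>g. \<psi> g (f x\<^sub>0)) ` B)) \<longleftrightarrow>
          compactin X (X closure_of ((\<lambda>g. \<phi> g x\<^sub>0) ` B))" if B: "B \<subseteq> carrier G" for B
    proof -
      have "(\<lambda>g. \<phi> g x\<^sub>0) ` B \<subseteq> topspace X" using B \<phi>X base_point by blast
      moreover have "(\<lambda>g. \<psi> g (f x\<^sub>0)) ` B = f ` ((\<lambda>g. \<phi> g x\<^sub>0) ` B)"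
        using \<psi>[OF base_point] by (simp add: image_image)
      ultimately show ?thesis
        using homeomorphic_map_closure_of[OF f] homeomorphic_map_compactness[OF f]
        by (simp add: closure_of_subset_topspace)
    qed
    then show ?thesis unfolding rel_compact_sets_def by blast
  qed
  show "gspace_type G Y \<psi> (f x\<^sub>0) = gspace_type G X \<phi> x\<^sub>0"
    unfolding gspace_type_def rc ..
qed

lemma (in pointed_lc_gspace) homeomorphic_copy:
  obtains Y :: "'g set set topology" and f h where "homeomorphic_maps X Y f h"
proof -
  define f where "f = (\<lambda>x. {S. S \<subseteq> carrier G \<and> x \<in> X closure_of ((\<lambda>g. \<phi> g x\<^sub>0) ` S)})"
  have inj: "inj_on f (topspace X)"
  proof (rule inj_onI, rule ccontr)
    fix x y assume x: "x \<in> topspace X" and y: "y \<in> topspace X"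
      and eq: "f x = f y" and ne: "x \<noteq> y"
    obtain U V where UV: "openin X U" "openin X V" "x \<in> U" "y \<in> V" "disjnt U V"
      using Hausdorff x y ne unfolding Hausdorff_space_def by blast
    let ?S = "{g \<in> carrier G. \<phi> g x\<^sub>0 \<in> U}"
    have "x \<in> X closure_of ((\<lambda>g. \<phi> g x\<^sub>0) ` ?S)"
      unfolding in_closure_of
    proof (intro conjI allI impI x)
      fix T assume "x \<in> T \<and> openin X T"
      then have "openin X (U \<inter> T)" "U \<inter> T \<noteq> {}" using UV by auto
      then have "orbit G \<phi> x\<^sub>0 \<inter> (U \<inter> T) \<noteq> {}"
        using dense_orbit unfolding dense_intersects_open by blast
      then show "\<exists>y. y \<in> (\<lambda>g. \<phi> g x\<^sub>0) ` ?S \<and> y \<in> T"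
        unfolding orbit_def by blast
    qed
    then have "?S \<in> f y" using eq by (auto simp: f_def)
    then have "y \<in> X closure_of ((\<lambda>g. \<phi> g x\<^sub>0) ` ?S)" by (simp add: f_def)
    then obtain z where "z \<in> (\<lambda>g. \<phi> g x\<^sub>0) ` ?S" "z \<in> V"
      using UV unfolding in_closure_of by meson
    then show False using UV unfolding disjnt_def by blast
  qed
  define h where "h = inv_into (topspace X) f"
  define Y where "Y = pullback_topology (f ` topspace X) h X"
  have hf: "h (f x) = x" if "x \<in> topspace X" for x
    using that inj by (simp add: h_def)
  have Y: "topspace Y = f ` topspace X"
    using hf by (auto simp: Y_def topspace_pullback_topology)
  have "continuous_map Y X h"
    unfolding continuous_map_def
  proof (intro conjI allI impI)
    show "h \<in> topspace Y \<rightarrow> topspace X" using hf Y by auto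
    show "openin Y {x \<in> topspace Y. h x \<in> U}" if "openin X U" for U
      unfolding Y using that by (auto simp: Y_def openin_pullback_topology)
  qed
  moreover have "continuous_map X Y f"
    unfolding continuous_map_def
  proof (intro conjI allI impI)
    show "f \<in> topspace X \<rightarrow> topspace Y" using Y by auto
    show "openin X {x \<in> topspace X. f x \<in> V}" if "openin Y V" for V
    proof -
      obtain U where U: "openin X U" "V = h -` U \<inter> f ` topspace X"
        using \<open>openin Y V\<close> unfolding Y_def openin_pullback_topology by blast
      then have "{x \<in> topspace X. f x \<in> V} = U"
        using hf openin_subset[OF U(1)] by auto
      then show ?thesis using U by simp
    qed
  qed
  ultimately have "homeomorphic_maps X Y f h"
    using hf Y by (auto simp: homeomorphic_maps_def)
  then show thesis using that by blast
qed

theorem of_minimal_typeI: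
  fixes X :: "'x topology" and G :: "('g, 'b) monoid_scheme"
  assumes "A \<in> nonempty_subsets G" "pointed_lc_gspace G X \<phi> x\<^sub>0"
    "minimal_gspace G X \<phi>" "gspace_type G X \<phi> x\<^sub>0 = approx_class G A"
  shows "of_minimal_type G A"
proof -
  interpret pointed_lc_gspace G X \<phi> x\<^sub>0 by fact
  obtain Y :: "'g set set topology" and f h where maps: "homeomorphic_maps X Y f h"
    using homeomorphic_copy by blast
  show ?thesis
    unfolding of_minimal_type_def
    using assms(1) transfer(1)[OF maps] transfer(2)[OF maps assms(3)] transfer(4)[OF maps] assms(4)
    by metis
qed

end

theory Submission
  imports Defs
begin

text \<open>
  Suppose that \<open>X\<close> is minimal and \<open>U\<close> is a non-empty relatively compact open subset. The return
  sets \<open>R\<^bsub>U\<^esub>(y) = {g. g.y \<in> U}\<close> satisfy \<open>T(G, X, y) = [R\<^bsub>U\<^esub>(y)]\<close>, and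
  \<open>R\<^bsub>U\<^esub>(x) g\<close> is the return set of \<open>g\<^sup>-\<^sup>1.x\<close>. Since every orbit is dense,
  \<open>R\<^bsub>U\<^esub>(y) \<succsim> R\<^bsub>U\<^esub>(x)\<close> for all \<open>x\<close> and \<open>y\<close>. Conversely, a non-empty limit of
  translates \<open>R\<^bsub>U\<^esub>(x) g\<^sub>n\<close> is \<open>\<approx>\<close>-equivalent to \<open>R\<^bsub>U\<^esub>(y)\<close> for a cluster point \<open>y\<close> of
  the points \<open>g\<^sub>n\<^sup>-\<^sup>1.x\<close>. So the type of \<open>X\<close> lies in a minimal \<open>\<sim>\<close>-class.

  For the other direction, let \<open>G\<close> act on \<open>2\<^sup>G\<close> by right translations. The non-empty sets form a
  locally compact \<open>G\<close>-space, and any \<open>A\<close> in it is its own return set to the compact open set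
  \<open>{S. 1 \<in> S}\<close>. Choose a minimal subshift \<open>N\<close> in the orbit closure of \<open>A\<close> and a non-empty
  \<open>C \<in> N\<close>. Then \<open>C \<precsim> A\<close>, so \<open>A \<precsim> C\<close> by minimality of \<open>A\<close>. Hence \<open>N\<close> contains some
  \<open>A' \<approx> A\<close>, and the non-empty sets in \<open>N\<close>, pointed at \<open>A'\<close>, have type \<open>[A]\<close>.
\<close>

section \<open>Return sets in minimal spaces\<close>

lemma succsimI:
  assumes "\<And>n. g n \<in> carrier G" "B' \<subseteq> carrier G"
    "set_converges G (\<lambda>n. A #>\<^bsub>G\<^esub> g n) B'" "approx G B B'"
  shows "succsim G A B"
  unfolding succsim_def using assms by (intro exI[of _ g] exI[of _ B'] conjI allI)

lemma (in group) approx_imp_succsim: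
  assumes "A \<subseteq> carrier G" "approx G B A"
  shows "succsim G A B"
  by (rule succsimI[of "\<lambda>_. \<one>" _ A])
     (use assms in \<open>simp_all add: coset_mult_one set_converges_def\<close>)

lemma (in group) subset_imp_dominated:
  assumes "A \<subseteq> B" "B \<subseteq> carrier G"
  shows "dominated G A B"
  using dominated_refl[OF assms(2)] assms(1) unfolding dominated_def by blast

text \<open>The \<open>n\<close>-th term handles the first \<open>n\<close> elements of an
  enumeration of \<open>S\<close>. This yields sequences of group elements from the countability of
  the group alone, without first countability of the space.\<close>

lemma countable_diagonal_sequence:
  fixes P :: "'a \<Rightarrow> 'c \<Rightarrow> bool"
  assumes "countable S" "\<And>F. finite F \<Longrightarrow> F \<subseteq> S \<Longrightarrow> \<exists>c\<in>C. \<forall>s\<in>F. P s c"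
  obtains c :: "nat \<Rightarrow> 'c" where "\<And>n. c n \<in> C" "\<And>s. s \<in> S \<Longrightarrow> \<forall>\<^sub>F n in sequentially. P s (c n)"
proof -
  \<comment> \<open>Intersecting with \<open>S\<close> covers empty \<open>S\<close>, where
    \<open>from_nat_into S\<close> takes values outside \<open>S\<close>.\<close>
  have "\<exists>c\<in>C. \<forall>s\<in>from_nat_into S ` {..n} \<inter> S. P s c" for n
    by (rule assms(2)) auto
  then obtain c where c: "\<And>n. c n \<in> C" "\<And>n s. s \<in> from_nat_into S ` {..n} \<inter> S \<Longrightarrow> P s (c n)"
    by metis
  have "\<forall>\<^sub>F n in sequentially. P s (c n)" if s: "s \<in> S" for s
  proof -
    obtain i where "from_nat_into S i = s" using from_nat_into_surj[OF assms(1) s] by blast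
    then have "P s (c n)" if "i \<le> n" for n using c(2)[of s n] s that by blast
    then show ?thesis unfolding eventually_sequentially by blast
  qed
  with c(1) show thesis by (rule that)
qed

text \<open>Otherwise \<open>K\<close> is covered by open sets that the sequence eventually avoids,
  and a finite subcover makes it avoid \<open>K\<close>. Since \<open>K\<close> need not be
  sequentially compact, only a cluster point is available, not a convergent subsequence.\<close>

lemma compactin_cluster_point:
  fixes z :: "nat \<Rightarrow> 'a"
  assumes K: "compactin X K" and ev: "\<forall>\<^sub>F n in sequentially. z n \<in> K"
  obtains y where "y \<in> K" "\<And>V. openin X V \<Longrightarrow> y \<in> V \<Longrightarrow> \<exists>\<^sub>F n in sequentially. z n \<in> V"
proof (rule ccontr)
  assume no: "\<not> thesis"
  define \<V> where "\<V> = {V. openin X V \<and> (\<forall>\<^sub>F n in sequentially. z n \<notin> V)}"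
  have "K \<subseteq> \<Union>\<V>"
    using no that unfolding \<V>_def frequently_def by blast
  then obtain \<F> where \<F>: "finite \<F>" "\<F> \<subseteq> \<V>" "K \<subseteq> \<Union>\<F>"
    using compactinD[OF K, of \<V>] unfolding \<V>_def by blast
  have "\<forall>\<^sub>F n in sequentially. \<forall>V\<in>\<F>. z n \<notin> V"
    using \<F> by (intro eventually_ball_finite) (auto simp: \<V>_def)
  with ev have "\<forall>\<^sub>F n in sequentially. False"
    by eventually_elim (use \<F> in blast)
  then show False by simp
qed

definition return_set ::
    "('g, 'b) monoid_scheme \<Rightarrow> ('g \<Rightarrow> 'x \<Rightarrow> 'x) \<Rightarrow> 'x set \<Rightarrow> 'x \<Rightarrow> 'g set" where
  "return_set G \<phi> U x = {g \<in> carrier G. \<phi> g x \<in> U}"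

context lc_gspace
begin

lemma return_set_subset: "return_set G \<phi> U x \<subseteq> carrier G"
  by (auto simp: return_set_def)

lemma return_set_nonempty:
  assumes "minimal_gspace G X \<phi>" "openin X U" "U \<noteq> {}" "x \<in> topspace X"
  shows "return_set G \<phi> U x \<in> nonempty_subsets G"
proof -
  have "orbit G \<phi> x \<inter> U \<noteq> {}"
    using assms unfolding minimal_gspace_def dense_intersects_open
    by (metis Int_absorb2 openin_subset)
  then show ?thesis by (auto simp: return_set_def nonempty_subsets_def orbit_def)
qed

lemma openin_preimage:
  assumes "g \<in> carrier G" "openin X U"
  shows "openin X {x \<in> topspace X. \<phi> g x \<in> U}"
  using homeomorphic_imp_continuous_map[OF homeomorphic_action[OF assms(1)]] assms(2)
  by (rule openin_continuous_map_preimage)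

lemma mem_return_set_r_coset:
  assumes "x \<in> topspace X" "g \<in> carrier G" "h \<in> carrier G"
  shows "h \<in> return_set G \<phi> U x #> g \<longleftrightarrow> \<phi> h (\<phi> (inv g) x) \<in> U"
proof -
  interpret group G by (rule is_group)
  show ?thesis
    using assms by (simp add: mem_r_coset_iff return_set_subset)
      (simp add: return_set_def composition_rule)
qed

text \<open>All orbits are dense, so the translates of \<open>U\<close> cover \<open>L\<close>, and
  finitely many suffice. If \<open>h.x\<close> lies in \<open>f.U\<close>, then
  \<open>inv f \<otimes> h\<close> is a return time to \<open>U\<close>.\<close>

lemma return_set_compact_dominated:
  assumes min: "minimal_gspace G X \<phi>" and U: "openin X U" "U \<noteq> {}"
    and L: "compactin X L" and x: "x \<in> topspace X"
  shows "dominated G (return_set G \<phi> L x) (return_set G \<phi> U x)"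
proof -
  interpret group G by (rule is_group)
  \<comment> \<open>\<open>V f\<close> is the translate \<open>f.U\<close>, written as a preimage so
    that it is open by continuity.\<close>
  define V where "V = (\<lambda>f. {y \<in> topspace X. \<phi> (inv f) y \<in> U})"
  have "y \<in> \<Union>(V ` carrier G)" if "y \<in> L" for y
  proof -
    have y: "y \<in> topspace X" using that compactin_subset_topspace[OF L] by blast
    obtain g where "g \<in> return_set G \<phi> U y"
      using return_set_nonempty[OF min U y] by (auto simp: nonempty_subsets_def)
    then have "inv g \<in> carrier G" "y \<in> V (inv g)" using y by (auto simp: V_def return_set_def)
    then show ?thesis by blast
  qed
  moreover have "openin X W" if "W \<in> V ` carrier G" for W
    using that openin_preimage U by (auto simp: V_def)
  ultimately obtain \<F> where \<F>: "finite \<F>" "\<F> \<subseteq> V ` carrier G" "L \<subseteq> \<Union>\<F>"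
    using compactinD[OF L, of "V ` carrier G"] by blast
  obtain F where F: "finite F" "F \<subseteq> carrier G" "\<F> = V ` F"
    using finite_subset_image[OF \<F>(1,2)] by blast
  have "return_set G \<phi> L x \<subseteq> F <#> return_set G \<phi> U x"
  proof
    fix h assume "h \<in> return_set G \<phi> L x"
    then have h: "h \<in> carrier G" "\<phi> h x \<in> L" by (auto simp: return_set_def)
    then obtain f where f: "f \<in> F" "\<phi> h x \<in> V f" using \<F>(3) F(3) by blast
    have fc: "f \<in> carrier G" using f F by blast
    have "inv f \<otimes> h \<in> return_set G \<phi> U x"
      using f h fc x by (simp add: return_set_def V_def composition_rule)
    moreover have "h = f \<otimes> (inv f \<otimes> h)" using h fc by (simp add: m_assoc[symmetric])
    ultimately show "h \<in> F <#> return_set G \<phi> U x" using f unfolding set_mult_def by blast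
  qed
  then show ?thesis using F unfolding dominated_def by blast
qed

text \<open>A limit of translated return sets to \<open>U\<close> need not be a return set to
  \<open>U\<close>, because of boundary points. What survives in the limit is a squeeze between
  \<open>U\<close> and a compact \<open>L\<close>, and this already determines the class.\<close>

lemma approx_return_set:
  assumes min: "minimal_gspace G X \<phi>" and U: "openin X U" "U \<noteq> {}"
    and L: "compactin X L" and x: "x \<in> topspace X"
    and B: "return_set G \<phi> U x \<subseteq> B" "B \<subseteq> return_set G \<phi> L x"
  shows "approx G B (return_set G \<phi> U x)"
proof -
  interpret group G by (rule is_group)
  have "B \<subseteq> carrier G" using B(2) return_set_subset by blast
  have "dominated G B (return_set G \<phi> U x)"
    using subset_imp_dominated[OF B(2) return_set_subset]
      return_set_compact_dominated[OF min U L x] return_set_subset by (rule dominated_trans)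
  then show ?thesis
    using subset_imp_dominated[OF B(1) \<open>B \<subseteq> carrier G\<close>] by (simp add: approx_def)
qed

text \<open>By density, \<open>g n\<close> can be chosen so that \<open>h.(g n).y\<close> is
  eventually in \<open>U\<close> if \<open>h.x\<close> is, and eventually outside \<open>L\<close>
  if \<open>h.x\<close> is. Any limit of the translates is then squeezed between the return sets of
  \<open>x\<close> to \<open>U\<close> and to \<open>L\<close>.\<close>

lemma succsim_return_set:
  assumes count: "countable (carrier G)"
    and min: "minimal_gspace G X \<phi>" and U: "openin X U" "U \<noteq> {}"
    and L: "compactin X L" "U \<subseteq> L" and xy: "x \<in> topspace X" "y \<in> topspace X"
  shows "succsim G (return_set G \<phi> U y) (return_set G \<phi> U x)"
proof -
  interpret group G by (rule is_group)
  \<comment> \<open>Nothing is required when \<open>h.x\<close> lies in \<open>L - U\<close>, so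
    both requirements are open conditions on \<open>g.y\<close> that hold at
    \<open>x\<close>.\<close>
  define P where "P = (\<lambda>h g. (\<phi> h x \<in> U \<longrightarrow> \<phi> h (\<phi> g y) \<in> U) \<and> (\<phi> h x \<notin> L \<longrightarrow> \<phi> h (\<phi> g y) \<notin> L))"
  define V where "V = (\<lambda>h. if \<phi> h x \<in> U then {z \<in> topspace X. \<phi> h z \<in> U}
    else if \<phi> h x \<notin> L then {z \<in> topspace X. \<phi> h z \<in> topspace X - L} else topspace X)"
  have \<phi>X: "\<phi> g z \<in> topspace X" if "g \<in> carrier G" "z \<in> topspace X" for g z
    using element_image that by blast
  have Lc: "openin X (topspace X - L)"
    using compactin_imp_closedin[OF Hausdorff L(1)] by blast
  have V: "openin X (V h)" "x \<in> V h" if "h \<in> carrier G" for h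
    using openin_preimage[OF that U(1)] openin_preimage[OF that Lc] xy \<phi>X[OF that]
    by (auto simp: V_def)
  have "\<exists>g\<in>carrier G. \<forall>h\<in>F. P h g" if F: "finite F" "F \<subseteq> carrier G" for F
  proof -
    \<comment> \<open>The factor \<open>topspace X\<close> keeps \<open>?W\<close> open when
      \<open>F\<close> is empty.\<close>
    let ?W = "topspace X \<inter> \<Inter>(V ` F)"
    have "openin X ?W"
      using F V(1) by (intro openin_Int_Inter) auto
    moreover have "x \<in> ?W" using F V(2) xy by auto
    ultimately have "return_set G \<phi> ?W y \<noteq> {}"
      using return_set_nonempty[OF min _ _ xy(2), of ?W] by (auto simp: nonempty_subsets_def)
    then obtain g where "g \<in> carrier G" "\<phi> g y \<in> ?W" by (auto simp: return_set_def)
    moreover have "P h g" if "\<phi> g y \<in> V h" for h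
      using that L(2) by (auto simp: P_def V_def split: if_splits)
    ultimately have "g \<in> carrier G" "\<forall>h\<in>F. P h g" by auto
    then show ?thesis by blast
  qed
  then obtain g where g: "\<And>n. g n \<in> carrier G"
    and P: "\<And>h. h \<in> carrier G \<Longrightarrow> \<forall>\<^sub>F n in sequentially. P h (g n)"
    using countable_diagonal_sequence[OF count, of "carrier G" P] by metis
  \<comment> \<open>\<open>P\<close> leaves the times \<open>h\<close> with \<open>h.x\<close> in
    \<open>L - U\<close> undecided, so convergence there needs a subsequence.\<close>
  obtain r C where r: "strict_mono r" and C: "C \<subseteq> carrier G"
    and conv: "set_converges G ((\<lambda>n. return_set G \<phi> U y #> inv (g n)) \<circ> r) C"
    using set_converges_subsequence[OF count] by blast
  have ev: "\<forall>\<^sub>F n in sequentially. (\<phi> h (\<phi> (g (r n)) y) \<in> U \<longleftrightarrow> h \<in> C) \<and> P h (g (r n))"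
    if h: "h \<in> carrier G" for h
  proof (rule eventually_conj)
    have eq: "h \<in> return_set G \<phi> U y #> inv (g (r n)) \<longleftrightarrow> \<phi> h (\<phi> (g (r n)) y) \<in> U" for n
      using mem_return_set_r_coset[OF xy(2) _ h, of "inv (g (r n))"] g by simp
    have "\<forall>\<^sub>F n in sequentially. h \<in> return_set G \<phi> U y #> inv (g (r n)) \<longleftrightarrow> h \<in> C"
      using conv h by (simp add: set_converges_iff)
    then show "\<forall>\<^sub>F n in sequentially. \<phi> h (\<phi> (g (r n)) y) \<in> U \<longleftrightarrow> h \<in> C"
      unfolding eq .
    show "\<forall>\<^sub>F n in sequentially. P h (g (r n))"
      using P[OF h] filterlim_subseq[OF r] by (rule eventually_compose_filterlim)
  qed
  have "(\<phi> h x \<in> U \<longrightarrow> h \<in> C) \<and> (h \<in> C \<longrightarrow> \<phi> h x \<in> L)" if h: "h \<in> carrier G" for h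
    using eventually_happens'[OF sequentially_bot ev[OF h]] L(2) unfolding P_def by blast
  then have "return_set G \<phi> U x \<subseteq> C" "C \<subseteq> return_set G \<phi> L x"
    using C by (auto simp: return_set_def)
  then have approx: "approx G (return_set G \<phi> U x) C"
    using approx_return_set[OF min U L(1) xy(1)] approx_sym by blast
  have "set_converges G (\<lambda>n. return_set G \<phi> U y #> inv (g (r n))) C"
    using conv by (simp add: o_def)
  with inv_closed[OF g] C show ?thesis using approx by (rule succsimI)
qed

text \<open>Some \<open>b\<close> in \<open>B\<close> forces \<open>b.(z n)\<close> into
  \<open>U\<close> eventually, so \<open>z n\<close> stays in a compact translate of
  \<open>L\<close> and has a cluster point \<open>y\<close>. Openness of \<open>U\<close> and of the
  complement of \<open>L\<close> squeezes \<open>B\<close> between the return sets of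
  \<open>y\<close>.\<close>

lemma return_set_limit:
  assumes min: "minimal_gspace G X \<phi>" and U: "openin X U" "U \<noteq> {}"
    and L: "compactin X L" "U \<subseteq> L" and x: "x \<in> topspace X"
    and g: "\<And>n. g n \<in> carrier G" and B: "B \<subseteq> carrier G" "B \<noteq> {}"
    and conv: "set_converges G (\<lambda>n. return_set G \<phi> U x #> g n) B"
  obtains y where "y \<in> topspace X" "approx G B (return_set G \<phi> U y)"
proof -
  interpret group G by (rule is_group)
  define z where "z = (\<lambda>n. \<phi> (inv (g n)) x)"
  have zX: "z n \<in> topspace X" for n
    unfolding z_def using element_image x g by blast
  have ev: "\<forall>\<^sub>F n in sequentially. \<phi> h (z n) \<in> U \<longleftrightarrow> h \<in> B" if "h \<in> carrier G" for h
    using conv that unfolding set_converges_iff z_def mem_return_set_r_coset[OF x g that, symmetric]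
    by blast
  obtain b where b: "b \<in> B" using B by blast
  then have bc: "b \<in> carrier G" using B by blast
  let ?K = "\<phi> (inv b) ` L"
  have K: "compactin X ?K"
    using image_compactin[OF L(1)] homeomorphic_action homeomorphic_imp_continuous_map bc
    by blast
  have "\<forall>\<^sub>F n in sequentially. z n \<in> ?K"
    using ev[OF bc]
  proof eventually_elim
    case (elim n)
    have "z n = \<phi> (inv b) (\<phi> b (z n))" using orbit_sym_aux bc zX by metis
    then show ?case using elim b L(2) by blast
  qed
  then obtain y where y: "y \<in> ?K"
    and cl: "\<And>V. openin X V \<Longrightarrow> y \<in> V \<Longrightarrow> \<exists>\<^sub>F n in sequentially. z n \<in> V"
    using compactin_cluster_point[OF K] by metis
  have yX: "y \<in> topspace X" using y compactin_subset_topspace[OF K] by blast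
  \<comment> \<open>Visits near \<open>y\<close> occur only frequently, but agreement with
    \<open>B\<close> holds eventually, so both occur together.\<close>
  have fr: "\<exists>\<^sub>F n in sequentially. \<phi> h (z n) \<in> V \<and> (\<phi> h (z n) \<in> U \<longleftrightarrow> h \<in> B)"
    if "h \<in> carrier G" "openin X V" "\<phi> h y \<in> V" for h V
  proof -
    have "\<exists>\<^sub>F n in sequentially. z n \<in> {z \<in> topspace X. \<phi> h z \<in> V}"
      using cl[OF openin_preimage[OF that(1,2)]] yX that(3) by blast
    then have "\<exists>\<^sub>F n in sequentially. \<phi> h (z n) \<in> V"
      by (rule frequently_elim1) simp
    from frequently_eventually_conj[OF this ev[OF that(1)]] show ?thesis
      by (rule frequently_elim1) simp
  qed
  have "return_set G \<phi> U y \<subseteq> B"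
    using frequently_ex[OF fr[OF _ U(1)]] by (auto simp: return_set_def)
  moreover have "B \<subseteq> return_set G \<phi> L y"
  proof
    fix h assume h: "h \<in> B"
    then have hc: "h \<in> carrier G" using B by blast
    have "openin X (topspace X - L)"
      using compactin_imp_closedin[OF Hausdorff L(1)] by blast
    then have "\<phi> h y \<in> L"
      using frequently_ex[OF fr[OF hc, of "topspace X - L"]] h L(2) element_image[OF hc yX] by blast
    then show "h \<in> return_set G \<phi> L y" using hc by (simp add: return_set_def)
  qed
  ultimately have "approx G B (return_set G \<phi> U y)"
    using approx_return_set[OF min U L(1) yX] by blast
  with yX show thesis by (rule that)
qed

end

section \<open>The type of a minimal space and the forward implication\<close>

text \<open>The return set moves the base point only within \<open>L\<close>, hence is dominated by
  the set \<open>A\<close> representing the type. Conversely, \<open>A\<close> consists of return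
  times to a compact orbit closure, and these are dominated by return times to
  \<open>U\<close>.\<close>

lemma (in pointed_lc_gspace) gspace_type_minimal:
  assumes min: "minimal_gspace G X \<phi>" and U: "openin X U" "U \<noteq> {}"
    and L: "compactin X L" "U \<subseteq> L"
  shows "gspace_type G X \<phi> x\<^sub>0 = approx_class G (return_set G \<phi> U x\<^sub>0)"
proof -
  interpret group G by (rule is_group)
  let ?R = "return_set G \<phi> U x\<^sub>0"
  have R: "?R \<in> nonempty_subsets G" using return_set_nonempty[OF min U base_point] .
  note co = minimal_imp_cocompact[OF min]
  obtain A where A: "A \<in> nonempty_subsets G"
    and rc: "rel_compact_sets G X \<phi> x\<^sub>0 = dominated_sets G A"
    using rel_compact_sets_eq_dominated_sets[OF co] by blast
  have "X closure_of ((\<lambda>g. \<phi> g x\<^sub>0) ` ?R) \<subseteq> L"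
    using L(2) by (intro closure_of_minimal compactin_imp_closedin[OF Hausdorff L(1)])
      (auto simp: return_set_def)
  then have "?R \<in> rel_compact_sets G X \<phi> x\<^sub>0"
    using closed_compactin[OF L(1)] return_set_subset by (simp add: rel_compact_sets_def)
  then have RA: "dominated G ?R A" by (simp add: rc dominated_sets_def)
  have "A \<in> rel_compact_sets G X \<phi> x\<^sub>0"
    using A dominated_refl by (auto simp: rc dominated_sets_def nonempty_subsets_def)
  then have Ac: "A \<subseteq> carrier G" and K: "compactin X (X closure_of ((\<lambda>g. \<phi> g x\<^sub>0) ` A))"
    by (auto simp: rel_compact_sets_def)
  have "(\<lambda>g. \<phi> g x\<^sub>0) ` A \<subseteq> X closure_of ((\<lambda>g. \<phi> g x\<^sub>0) ` A)"
    using Ac element_image base_point by (intro closure_of_subset) blast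
  then have "A \<subseteq> return_set G \<phi> (X closure_of ((\<lambda>g. \<phi> g x\<^sub>0) ` A)) x\<^sub>0"
    using Ac by (auto simp: return_set_def)
  then have "dominated G A ?R"
    using dominated_trans[OF subset_imp_dominated[OF _ return_set_subset]
        return_set_compact_dominated[OF min U K base_point] return_set_subset] by blast
  with RA have "approx G A ?R" by (simp add: approx_def)
  then show ?thesis
    using gspace_type_eq_iff[OF co R] rc dominated_sets_eq_iff[OF A R] by simp
qed

lemma of_minimal_type_imp_minimal:
  fixes G (structure)
  assumes "of_minimal_type G A" "countable (carrier G)"
    and B: "B \<subseteq> carrier G" "B \<noteq> {}" "precsim G B A"
  shows "sim G B A"
proof -
  obtain X :: "'a set set topology" and \<phi> x\<^sub>0 where A: "A \<in> nonempty_subsets G"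
    and "pointed_lc_gspace G X \<phi> x\<^sub>0" and min: "minimal_gspace G X \<phi>"
    and type: "gspace_type G X \<phi> x\<^sub>0 = approx_class G A"
    using assms(1) unfolding of_minimal_type_def by blast
  interpret pointed_lc_gspace G X \<phi> x\<^sub>0 by fact
  interpret group G by (rule is_group)
  obtain U L where UL: "openin X U" "compactin X L" "x\<^sub>0 \<in> U" "U \<subseteq> L"
    using locally_compact base_point unfolding locally_compact_space_def by blast
  then have ne: "U \<noteq> {}" by blast
  let ?R = "return_set G \<phi> U"
  have Ac: "A \<subseteq> carrier G" using A by (simp add: nonempty_subsets_def)
  have AR: "approx G A (?R x\<^sub>0)"
    using gspace_type_minimal[OF min UL(1) ne UL(2,4)] type
      approx_class_eq_iff[OF A return_set_nonempty[OF min UL(1) ne base_point]] by simp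
  have "succsim G (?R x\<^sub>0) B"
    using succsim_trans[OF assms(2) return_set_subset Ac B(1)]
      approx_imp_succsim[OF return_set_subset AR] B(3) .
  then obtain g B' where g: "\<And>n. g n \<in> carrier G" and B': "B' \<subseteq> carrier G"
    and conv: "set_converges G (\<lambda>n. ?R x\<^sub>0 #> g n) B'" and BB: "approx G B B'"
    unfolding succsim_def by blast
  \<comment> \<open>\<open>B\<close> is non-empty and dominated by \<open>B'\<close>, whereas the
    empty set dominates only itself.\<close>
  have "B' \<noteq> {}" using BB B(2) by (auto simp: approx_def dominated_def set_mult_def)
  then obtain y where y: "y \<in> topspace X" "approx G B' (?R y)"
    using return_set_limit[OF min UL(1) ne UL(2,4) base_point g B' _ conv] by blast
  have "approx G (?R y) B"
    using approx_trans[OF BB y(2) B(1) return_set_subset] approx_sym by blast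
  then have "succsim G B (?R y)" by (rule approx_imp_succsim[OF B(1)])
  moreover have "succsim G (?R y) (?R x\<^sub>0)"
    using succsim_return_set[OF assms(2) min UL(1) ne UL(2,4) base_point y(1)] .
  moreover have "succsim G (?R x\<^sub>0) A"
    using approx_imp_succsim[OF return_set_subset AR] .
  \<comment> \<open>The chain runs from \<open>B\<close> through the return sets of \<open>y\<close>
    and \<open>x\<^sub>0\<close> to \<open>A\<close>.\<close>
  ultimately have "succsim G B A"
    using succsim_trans[OF assms(2)] B(1) Ac return_set_subset by metis
  then show ?thesis using B(3) by (simp add: sim_def)
qed

section \<open>Shift spaces\<close>

text \<open>A subset of \<open>G\<close> is represented by its indicator function, extensional on the carrier.\<close>

definition shift_topology :: "('g, 'b) monoid_scheme \<Rightarrow> ('g \<Rightarrow> bool) topology" where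
  "shift_topology G = product_topology (\<lambda>_. discrete_topology UNIV) (carrier G)"

text \<open>Precomposition with right multiplication is a left action. It sends the indicator of
  \<open>S\<close> to that of \<open>S #> inv g\<close>, and the value at \<open>\<one>\<close>
  becomes \<open>f g\<close>.\<close>

definition right_shift ::
    "('g, 'b) monoid_scheme \<Rightarrow> 'g \<Rightarrow> ('g \<Rightarrow> bool) \<Rightarrow> 'g \<Rightarrow> bool" where
  "right_shift G g f = (\<lambda>h\<in>carrier G. f (h \<otimes>\<^bsub>G\<^esub> g))"

definition shift_invariant :: "('g, 'b) monoid_scheme \<Rightarrow> ('g \<Rightarrow> bool) set \<Rightarrow> bool" where
  "shift_invariant G N \<longleftrightarrow> (\<forall>g\<in>carrier G. \<forall>f\<in>N. right_shift G g f \<in> N)"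

text \<open>For an invariant set, the last clause says that some member is not identically false.
  Stated at \<open>\<one>\<close>, it concerns a compact open set and so passes to intersections of
  chains.\<close>

definition subshift :: "('g, 'b) monoid_scheme \<Rightarrow> ('g \<Rightarrow> bool) set \<Rightarrow> bool" where
  "subshift G N \<longleftrightarrow> closedin (shift_topology G) N \<and> shift_invariant G N \<and> (\<exists>f\<in>N. f \<one>\<^bsub>G\<^esub>)"

definition minimal_subshift :: "('g, 'b) monoid_scheme \<Rightarrow> ('g \<Rightarrow> bool) set \<Rightarrow> bool" where
  "minimal_subshift G N \<longleftrightarrow> subshift G N \<and> (\<forall>N'\<subseteq>N. subshift G N' \<longrightarrow> N' = N)"

text \<open>Removing the zero configuration, a fixed point, leaves an open and so locally compact
  part of a compact space.\<close>

definition nonzero_part :: "('g, 'b) monoid_scheme \<Rightarrow> ('g \<Rightarrow> bool) set \<Rightarrow> ('g \<Rightarrow> bool) set" where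
  "nonzero_part G N = {f \<in> N. \<exists>h\<in>carrier G. f h}"

lemma topspace_shift_topology: "topspace (shift_topology G) = extensional (carrier G)"
  by (auto simp: shift_topology_def PiE_def)

lemma compact_space_shift_topology: "compact_space (shift_topology G)"
  by (simp add: shift_topology_def compact_space_product_topology compact_space_discrete_topology)

lemma Hausdorff_space_shift_topology: "Hausdorff_space (shift_topology G)"
  by (simp add: shift_topology_def Hausdorff_space_product_topology)

lemma right_shift_in_topspace: "right_shift G g f \<in> topspace (shift_topology G)"
  by (simp add: topspace_shift_topology right_shift_def)

lemma continuous_map_eval:
  "h \<in> carrier G \<Longrightarrow> continuous_map (shift_topology G) (discrete_topology UNIV) (\<lambda>f. f h)"
  unfolding shift_topology_def by (rule continuous_map_product_projection)

lemma openin_eval: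
  assumes "h \<in> carrier G"
  shows "openin (shift_topology G) {f \<in> topspace (shift_topology G). f h = c}"
  using openin_continuous_map_preimage[OF continuous_map_eval[OF assms], of "{c}"] by simp

lemma compactin_eval:
  assumes "h \<in> carrier G" "closedin (shift_topology G) N"
  shows "compactin (shift_topology G) {f \<in> N. f h}"
proof -
  have "closedin (shift_topology G) {f \<in> topspace (shift_topology G). f h \<in> {True}}"
    using closedin_continuous_map_preimage[OF continuous_map_eval[OF assms(1)], of "{True}"] by simp
  then have "closedin (shift_topology G) (N \<inter> {f \<in> topspace (shift_topology G). f h \<in> {True}})"
    using assms(2) by blast
  also have "N \<inter> {f \<in> topspace (shift_topology G). f h \<in> {True}} = {f \<in> N. f h}"
    using closedin_subset[OF assms(2)] by blast
  finally show ?thesis by (rule closedin_compact_space[OF compact_space_shift_topology])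
qed

lemma limit_in_closed_shift:
  assumes N: "closedin (shift_topology G) N" and S: "set_converges G S B"
    and mem: "\<And>n. (\<lambda>h\<in>carrier G. h \<in> S n) \<in> N"
  shows "(\<lambda>h\<in>carrier G. h \<in> B) \<in> N"
proof (rule limitin_closedin[OF _ N])
  have "limitin (discrete_topology UNIV) (\<lambda>n. h \<in> S n) (h \<in> B) sequentially"
    if "h \<in> carrier G" for h
    using S that by (auto simp: limitin_def set_converges_iff elim!: eventually_mono)
  then show "limitin (shift_topology G) (\<lambda>n. \<lambda>h\<in>carrier G. h \<in> S n) (\<lambda>h\<in>carrier G. h \<in> B)
      sequentially"
    unfolding shift_topology_def limitin_componentwise by simp
  show "\<forall>\<^sub>F n in sequentially. (\<lambda>h\<in>carrier G. h \<in> S n) \<in> N" using mem by simp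
qed simp

section \<open>Right translations and minimal subshifts\<close>

context group
begin

lemma right_shift_mult:
  "g \<in> carrier G \<Longrightarrow> h \<in> carrier G \<Longrightarrow>
    right_shift G g (right_shift G h f) = right_shift G (g \<otimes> h) f"
  unfolding right_shift_def by (rule restrict_ext) (simp add: m_assoc)

lemma right_shift_one: "f \<in> topspace (shift_topology G) \<Longrightarrow> right_shift G \<one> f = f"
  unfolding right_shift_def topspace_shift_topology
  by (rule extensionalityI[of _ "carrier G"]) auto

lemma continuous_map_right_shift:
  assumes "g \<in> carrier G"
  shows "continuous_map (shift_topology G) (shift_topology G) (right_shift G g)"
proof -
  have "continuous_map (shift_topology G) (discrete_topology UNIV) (\<lambda>f. right_shift G g f k)"
    if "k \<in> carrier G" for k
    using continuous_map_eval[of "k \<otimes> g" G] that assms by (simp add: right_shift_def)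
  then show ?thesis
    unfolding shift_topology_def continuous_map_componentwise
    by (auto simp: right_shift_def)
qed

lemma right_shift_indicator:
  assumes "S \<subseteq> carrier G" "g \<in> carrier G"
  shows "right_shift G (inv g) (\<lambda>h\<in>carrier G. h \<in> S) = (\<lambda>h\<in>carrier G. h \<in> S #> g)"
  unfolding right_shift_def
  by (rule restrict_ext) (use assms in \<open>simp add: mem_r_coset_iff\<close>)

lemma shift_invariant_nonzero_part:
  assumes "shift_invariant G N"
  shows "shift_invariant G (nonzero_part G N)"
  unfolding shift_invariant_def
proof (intro ballI)
  fix g f assume g: "g \<in> carrier G" and "f \<in> nonzero_part G N"
  then obtain h where h: "f \<in> N" "h \<in> carrier G" "f h" by (auto simp: nonzero_part_def)
  then have "right_shift G g f (h \<otimes> inv g)" using g by (simp add: right_shift_def m_assoc)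
  then show "right_shift G g f \<in> nonzero_part G N"
    using h g assms unfolding nonzero_part_def shift_invariant_def
    by (metis (no_types, lifting) inv_closed m_closed mem_Collect_eq)
qed

lemma shift_invariant_meets:
  assumes "shift_invariant G N" "f \<in> nonzero_part G N"
  shows "\<exists>f\<in>N. f \<one>"
proof -
  obtain h where h: "f \<in> N" "h \<in> carrier G" "f h" using assms by (auto simp: nonzero_part_def)
  then have "right_shift G h f \<in> N" "right_shift G h f \<one>"
    using assms by (auto simp: right_shift_def shift_invariant_def)
  then show ?thesis by blast
qed

lemma subshift_orbit_closure:
  assumes "f \<in> topspace (shift_topology G)" "h \<in> carrier G" "f h"
  shows "subshift G (shift_topology G closure_of ((\<lambda>g. right_shift G g f) ` carrier G))"
    (is "subshift G (?T closure_of ?O)")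
proof -
  have O: "?O \<subseteq> ?T closure_of ?O"
    by (intro closure_of_subset) (simp add: image_subset_iff right_shift_in_topspace)
  have inv: "shift_invariant G (?T closure_of ?O)"
    unfolding shift_invariant_def
  proof (intro ballI)
    fix g k assume g: "g \<in> carrier G" and k: "k \<in> ?T closure_of ?O"
    have "right_shift G g ` ?O \<subseteq> ?O"
      using g by (auto simp: right_shift_mult)
    then have "?T closure_of (right_shift G g ` ?O) \<subseteq> ?T closure_of ?O"
      by (rule closure_of_mono)
    then show "right_shift G g k \<in> ?T closure_of ?O"
      using continuous_map_image_closure_subset[OF continuous_map_right_shift[OF g]] k by blast
  qed
  have "f \<in> ?O" using right_shift_one[OF assms(1)] by force
  then have "f \<in> nonzero_part G (?T closure_of ?O)"
    using O assms(2,3) by (auto simp: nonzero_part_def)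
  then show ?thesis
    using inv shift_invariant_meets[OF inv] by (auto simp: subshift_def)
qed

lemma exists_minimal_subshift:
  assumes Z: "subshift G Z"
  obtains N where "N \<subseteq> Z" "minimal_subshift G N"
proof -
  let ?T = "shift_topology G"
  \<comment> \<open>Zorn's lemma is applied to complements, so that compactness of \<open>{f. f \<one>}\<close> keeps the
    union of a chain from covering it.\<close>
  define \<A> where "\<A> = {W. W \<subseteq> topspace ?T \<and> topspace ?T - W \<subseteq> Z \<and> subshift G (topspace ?T - W)}"
  have sub: "N \<subseteq> topspace ?T" if "subshift G N" for N
    using that closedin_subset by (auto simp: subshift_def)
  have dd: "topspace ?T - (topspace ?T - N) = N" if "subshift G N" for N
    using sub[OF that] by blast
  have "topspace ?T - Z \<in> \<A>"
    using Z dd[OF Z] by (simp add: \<A>_def)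
  moreover have "\<Union>\<C> \<in> \<A>" if ne: "\<C> \<noteq> {}" and ch: "subset.chain \<A> \<C>" for \<C>
  proof -
    have C: "W \<subseteq> topspace ?T" "topspace ?T - W \<subseteq> Z" "closedin ?T (topspace ?T - W)"
      "openin ?T W" "shift_invariant G (topspace ?T - W)" "\<exists>f\<in>topspace ?T - W. f \<one>"
      if "W \<in> \<C>" for W
      using ch that unfolding subset.chain_def \<A>_def subshift_def
      by (auto simp: openin_closedin_eq)
    have "openin ?T (\<Union>\<C>)" using C(4) by blast
    moreover have "shift_invariant G (topspace ?T - \<Union>\<C>)"
      using C(5) right_shift_in_topspace[of G] unfolding shift_invariant_def by blast
    moreover have "\<exists>f\<in>topspace ?T - \<Union>\<C>. f \<one>"
    proof (rule ccontr)
      let ?U = "{f \<in> topspace ?T. f \<one>}"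
      assume "\<not> ?thesis"
      then have "?U \<subseteq> \<Union>\<C>" by blast
      then obtain \<F> where \<F>: "finite \<F>" "\<F> \<subseteq> \<C>" "?U \<subseteq> \<Union>\<F>"
        using compactinD[OF compactin_eval[of \<one> G "topspace ?T"], of \<C>] C(4) by auto
      have "?U \<noteq> {}" using ne C(6) by blast
      then have "\<F> \<noteq> {}" using \<F>(3) by auto
      moreover have "subset.chain \<A> \<F>"
        using ch subset_trans[OF \<F>(2)] subsetD[OF \<F>(2)] by (simp add: subset_chain_def)
      \<comment> \<open>A finite non-empty chain contains its union, so a single member of
        \<open>\<C>\<close> would already cover \<open>?U\<close>.\<close>
      ultimately have "\<Union>\<F> \<in> \<F>" by (rule Union_in_chain[OF \<F>(1)])
      then have "\<Union>\<F> \<in> \<C>" using \<F>(2) by blast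
      from C(6)[OF this] show False using \<F>(3) by auto
    qed
    ultimately show ?thesis
      using ne C(1,2) unfolding \<A>_def subshift_def by blast
  qed
  ultimately obtain W where W: "W \<in> \<A>" "\<And>W'. W' \<in> \<A> \<Longrightarrow> W \<subseteq> W' \<Longrightarrow> W' = W"
    using subset_Zorn_nonempty[of \<A>] by blast
  let ?N = "topspace ?T - W"
  have "N' = ?N" if N': "N' \<subseteq> ?N" "subshift G N'" for N'
  proof -
    have "topspace ?T - N' \<in> \<A>" "W \<subseteq> topspace ?T - N'"
      using W(1) N' dd[OF N'(2)] by (auto simp: \<A>_def)
    then have "topspace ?T - N' = W" by (rule W(2))
    then show ?thesis using dd[OF N'(2)] by simp
  qed
  then have "minimal_subshift G ?N" using W(1) by (simp add: minimal_subshift_def \<A>_def)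
  moreover have "?N \<subseteq> Z" using W(1) by (simp add: \<A>_def)
  ultimately show thesis using that by blast
qed

text \<open>The orbit closure of a nonzero configuration of \<open>N\<close> is a subshift inside
  \<open>N\<close>, hence all of \<open>N\<close>; so every orbit is dense in the nonzero
  part.\<close>

lemma minimal_subshift_lc_gspace:
  fixes N
  defines "M \<equiv> nonzero_part G N"
  \<comment> \<open>Restricting to \<open>M\<close> makes each map extensional, as membership in
    \<open>Bij M\<close> demands.\<close>
  defines "X \<equiv> subtopology (shift_topology G) M" and "\<phi> \<equiv> \<lambda>g. restrict (right_shift G g) M"
  assumes min: "minimal_subshift G N"
  shows "lc_gspace G X \<phi>" and "minimal_gspace G X \<phi>" and "topspace X = M"
proof -
  let ?T = "shift_topology G"
  have N: "closedin ?T N" "shift_invariant G N" "\<exists>f\<in>N. f \<one>"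
    using min by (auto simp: minimal_subshift_def subshift_def)
  have MT: "M \<subseteq> topspace ?T" "M \<subseteq> N"
    using closedin_subset[OF N(1)] by (auto simp: M_def nonzero_part_def)
  then show X: "topspace X = M" by (auto simp: X_def)
  have M: "right_shift G g f \<in> M" if "g \<in> carrier G" "f \<in> M" for g f
    using shift_invariant_nonzero_part[OF N(2)] that by (simp add: shift_invariant_def M_def)
  have \<phi>M: "\<phi> g f = right_shift G g f" if "f \<in> M" for g f using that by (simp add: \<phi>_def)
  have cont: "continuous_map X X (\<phi> g)" if "g \<in> carrier G" for g
  proof -
    have "continuous_map X X (right_shift G g)"
      using continuous_map_right_shift[OF that] M[OF that] MT
      by (auto simp: X_def continuous_map_in_subtopology intro: continuous_map_from_subtopology)
    then show ?thesis by (rule continuous_map_eq) (simp add: X \<phi>M)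
  qed
  have \<phi>\<phi>: "\<phi> g (\<phi> h f) = \<phi> (g \<otimes> h) f" if "g \<in> carrier G" "h \<in> carrier G" "f \<in> M" for g h f
    using that M by (simp add: \<phi>M right_shift_mult)
  have \<phi>1: "\<phi> \<one> f = f" if "f \<in> M" for f
    using that MT(1) right_shift_one by (auto simp: \<phi>M)
  have hom: "homeomorphic_map X X (\<phi> g)" if g: "g \<in> carrier G" for g
  proof -
    have "homeomorphic_maps X X (\<phi> g) (\<phi> (inv g))"
      using g cont \<phi>\<phi> \<phi>1 by (auto simp: homeomorphic_maps_def X)
    then show ?thesis using homeomorphic_maps_map by blast
  qed
  have Bij: "\<phi> g \<in> Bij M" if "g \<in> carrier G" for g
    using homeomorphic_imp_surjective_map[OF hom[OF that]]
      homeomorphic_imp_injective_map[OF hom[OF that]]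
    by (simp add: Bij_def bij_betw_def X) (simp add: \<phi>_def)
  have act: "group_action G (topspace X) \<phi>"
  proof (intro group_action.intro group_hom.intro group_hom_axioms.intro homI
      is_group group_BijGroup)
    show "\<phi> g \<in> carrier (BijGroup (topspace X))" if "g \<in> carrier G" for g
      using Bij[OF that] by (simp add: BijGroup_def X)
    show "\<phi> (g \<otimes> k) = \<phi> g \<otimes>\<^bsub>BijGroup (topspace X)\<^esub> \<phi> k"
      if gk: "g \<in> carrier G" "k \<in> carrier G" for g k
    proof -
      have "\<phi> (g \<otimes> k) = compose M (\<phi> g) (\<phi> k)"
        by (rule extensionalityI[of _ M]) (simp_all add: compose_def gk \<phi>\<phi>, simp add: \<phi>_def)
      then show ?thesis using gk Bij by (simp add: BijGroup_def X)
    qed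
  qed
  have "openin ?T (\<Union>h\<in>carrier G. {f \<in> topspace ?T. f h = True})"
    using openin_eval[of _ G True] by blast
  then have "openin (subtopology ?T N) (N \<inter> (\<Union>h\<in>carrier G. {f \<in> topspace ?T. f h = True}))"
    by (rule openin_subtopology_Int2)
  moreover have "N \<inter> (\<Union>h\<in>carrier G. {f \<in> topspace ?T. f h = True}) = M"
    using closedin_subset[OF N(1)] by (auto simp: M_def nonzero_part_def)
  ultimately have "openin (subtopology ?T N) M" by simp
  then have "locally_compact_space (subtopology (subtopology ?T N) M)"
    using compact_imp_locally_compact_space[OF compact_space_shift_topology]
      locally_compact_space_closed_subset[OF _ N(1)]
      Hausdorff_space_subtopology[OF Hausdorff_space_shift_topology]
    by (intro locally_compact_space_open_subset[where X = "subtopology ?T N"]) auto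
  then have "locally_compact_space X"
    using MT(2) by (simp add: X_def subtopology_subtopology inf_absorb2)
  then show "lc_gspace G X \<phi>"
    unfolding lc_gspace_def lc_gspace_axioms_def
    using act hom Hausdorff_space_subtopology[OF Hausdorff_space_shift_topology]
    by (simp add: X_def)
  show "minimal_gspace G X \<phi>"
    unfolding minimal_gspace_def X
  proof (intro conjI ballI)
    show "M \<noteq> {}" using N(3) by (auto simp: M_def nonzero_part_def)
    fix f assume f: "f \<in> M"
    let ?O = "(\<lambda>g. right_shift G g f) ` carrier G"
    have O: "orbit G \<phi> f = ?O" using f by (auto simp: orbit_def \<phi>M)
    have OM: "?O \<subseteq> M" using M f by blast
    have "?T closure_of ?O \<subseteq> N" using OM MT(2) by (intro closure_of_minimal N(1)) blast
    moreover have "subshift G (?T closure_of ?O)"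
      using f MT(1) subshift_orbit_closure by (auto simp: M_def nonzero_part_def)
    ultimately have "?T closure_of ?O = N" using min by (simp add: minimal_subshift_def)
    then show "X closure_of orbit G \<phi> f = M"
      unfolding O X_def closure_of_subtopology using OM MT(2) by (simp add: inf_absorb2 inf_absorb1)
  qed
qed

text \<open>The set of configurations true at \<open>\<one>\<close> is both compact and open, so it
  serves as \<open>U\<close> and \<open>L\<close> at once. The return set of \<open>f\<close> to it
  is exactly the support of \<open>f\<close>.\<close>

lemma minimal_subshift_of_minimal_type:
  assumes min: "minimal_subshift G N" and f: "f \<in> nonzero_part G N"
  shows "of_minimal_type G {h \<in> carrier G. f h}"
proof -
  let ?T = "shift_topology G"
  define M where "M = nonzero_part G N"
  define X where "X = subtopology ?T M"
  define \<phi> where "\<phi> = (\<lambda>g. restrict (right_shift G g) M)"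
  have lc: "lc_gspace G X \<phi>" and minX: "minimal_gspace G X \<phi>" and X: "topspace X = M"
    using minimal_subshift_lc_gspace[OF min] unfolding X_def \<phi>_def M_def by blast+
  have fM: "f \<in> M" using f by (simp add: M_def)
  have pt: "pointed_lc_gspace G X \<phi> f"
    using lc minX fM X
    unfolding pointed_lc_gspace_def pointed_lc_gspace_axioms_def minimal_gspace_def by blast
  interpret pointed_lc_gspace G X \<phi> f by (rule pt)
  have N: "closedin ?T N" "\<exists>f\<in>N. f \<one>" using min by (auto simp: minimal_subshift_def subshift_def)
  let ?U = "{f \<in> M. f \<one>}"
  have U: "?U = {f \<in> N. f \<one>}" by (auto simp: M_def nonzero_part_def)
  have "compactin X ?U"
    unfolding X_def compactin_subtopology using compactin_eval[OF one_closed N(1)] U by auto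
  moreover have "openin X ({f \<in> topspace ?T. f \<one> = True} \<inter> M)"
    unfolding X_def using openin_subtopology_Int[OF openin_eval[OF one_closed]] by blast
  moreover have "{f \<in> topspace ?T. f \<one> = True} \<inter> M = ?U"
    using X by (auto simp: X_def)
  ultimately have "gspace_type G X \<phi> f = approx_class G (return_set G \<phi> ?U f)"
    using gspace_type_minimal[OF minX, of ?U ?U] N(2) U by auto
  moreover have "return_set G \<phi> ?U f = {h \<in> carrier G. f h}"
  proof -
    have "\<phi> g f \<in> M" if "g \<in> carrier G" for g using element_image[OF that] fM X by blast
    then show ?thesis using fM by (auto simp: return_set_def \<phi>_def right_shift_def)
  qed
  ultimately have "gspace_type G X \<phi> f = approx_class G {h \<in> carrier G. f h}" by simp
  moreover have "{h \<in> carrier G. f h} \<in> nonempty_subsets G"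
    using f by (auto simp: nonempty_subsets_def nonzero_part_def)
  ultimately show ?thesis using pt minX by (intro of_minimal_typeI)
qed

section \<open>From a minimal class to a minimal subshift\<close>

lemma of_minimal_type_approx:
  assumes "of_minimal_type G A" "approx G A B" "B \<in> nonempty_subsets G"
  shows "of_minimal_type G B"
  using assms approx_class_eq_iff[of A B] unfolding of_minimal_type_def by metis

text \<open>Agreement with \<open>C\<close> on a finite window is an open condition, so some
  translate of \<open>A\<close> meets it; the diagonal sequence then handles all windows.\<close>

lemma succsim_orbit_closure:
  assumes count: "countable (carrier G)" and A: "A \<subseteq> carrier G" and C: "C \<subseteq> carrier G"
    and cl: "(\<lambda>h\<in>carrier G. h \<in> C) \<in> shift_topology G closure_of
      ((\<lambda>g. right_shift G g (\<lambda>h\<in>carrier G. h \<in> A)) ` carrier G)"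
  shows "succsim G A C"
proof -
  let ?T = "shift_topology G"
  have "\<exists>g\<in>carrier G. \<forall>h\<in>F. h \<in> A #> g \<longleftrightarrow> h \<in> C" if F: "finite F" "F \<subseteq> carrier G" for F
  proof -
    let ?W = "topspace ?T \<inter> (\<Inter>h\<in>F. {f \<in> topspace ?T. f h = (h \<in> C)})"
    have "openin ?T ?W"
      using F by (intro openin_Int_Inter) (auto intro!: openin_eval)
    moreover have "(\<lambda>h\<in>carrier G. h \<in> C) \<in> ?W"
      using F by (auto simp: topspace_shift_topology)
    ultimately obtain g where g: "g \<in> carrier G" "right_shift G g (\<lambda>h\<in>carrier G. h \<in> A) \<in> ?W"
      using cl unfolding in_closure_of by blast
    have "right_shift G g (\<lambda>h\<in>carrier G. h \<in> A) = (\<lambda>h\<in>carrier G. h \<in> A #> inv g)"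
      using right_shift_indicator[OF A, of "inv g"] g(1) by simp
    then have "h \<in> A #> inv g \<longleftrightarrow> h \<in> C" if "h \<in> F" for h
      using g(2) F(2) that by (auto simp: subset_iff)
    then show ?thesis using g(1) by (meson inv_closed)
  qed
  then obtain g where g: "\<And>n. g n \<in> carrier G"
    and ev: "\<And>h. h \<in> carrier G \<Longrightarrow> \<forall>\<^sub>F n in sequentially. h \<in> A #> g n \<longleftrightarrow> h \<in> C"
    using countable_diagonal_sequence[OF count, of "carrier G" "\<lambda>h g. h \<in> A #> g \<longleftrightarrow> h \<in> C"]
    by metis
  have "set_converges G (\<lambda>n. A #> g n) C" unfolding set_converges_iff using ev by blast
  with g C show ?thesis using approx_refl[OF C] by (rule succsimI)
qed

lemma minimal_imp_of_minimal_type: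
  assumes count: "countable (carrier G)" and A: "A \<subseteq> carrier G" "A \<noteq> {}"
    and least: "\<And>B. B \<subseteq> carrier G \<Longrightarrow> B \<noteq> {} \<Longrightarrow> precsim G B A \<Longrightarrow> sim G B A"
  shows "of_minimal_type G A"
proof -
  let ?T = "shift_topology G"
  let ?f = "\<lambda>S. \<lambda>h\<in>carrier G. h \<in> S"
  let ?Z = "?T closure_of ((\<lambda>g. right_shift G g (?f A)) ` carrier G)"
  obtain a where "a \<in> A" using A by blast
  then have "subshift G ?Z"
    using A by (intro subshift_orbit_closure[of _ a]) (auto simp: topspace_shift_topology)
  then obtain N where N: "N \<subseteq> ?Z" "minimal_subshift G N" by (rule exists_minimal_subshift)
  then have Nc: "closedin ?T N" and Ni: "shift_invariant G N" and "\<exists>f\<in>N. f \<one>"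
    by (auto simp: minimal_subshift_def subshift_def)
  then obtain c where c: "c \<in> N" "c \<one>" by blast
  define C where "C = {h \<in> carrier G. c h}"
  have C: "C \<subseteq> carrier G" "C \<noteq> {}" using c by (auto simp: C_def)
  have cC: "?f C = c"
    using c closedin_subset[OF Nc]
    by (intro extensionalityI[of _ "carrier G"]) (auto simp: C_def topspace_shift_topology)
  have "succsim G A C"
    using succsim_orbit_closure[OF count A(1) C(1)] N(1) c(1) cC by auto
  \<comment> \<open>Minimality is used here: it brings a set equivalent to \<open>A\<close> back as
    a limit of translates of \<open>C\<close>, and such limits stay in the closed invariant set
    \<open>N\<close>.\<close>
  then have "succsim G C A" using least C by (simp add: sim_def)
  then obtain g A' where g: "\<And>n. g n \<in> carrier G" and A': "A' \<subseteq> carrier G"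
    and conv: "set_converges G (\<lambda>n. C #> g n) A'" and AA: "approx G A A'"
    unfolding succsim_def by blast
  have "?f (C #> g n) \<in> N" for n
    using right_shift_indicator[OF C(1) g, of n] Ni c(1) g cC
    by (metis inv_closed shift_invariant_def)
  then have "?f A' \<in> N" using limit_in_closed_shift[OF Nc conv] by blast
  moreover have "A' \<noteq> {}" using AA A(2) by (auto simp: approx_def dominated_def set_mult_def)
  ultimately have "?f A' \<in> nonzero_part G N" using A' by (auto simp: nonzero_part_def)
  then have "of_minimal_type G {h \<in> carrier G. ?f A' h}"
    by (rule minimal_subshift_of_minimal_type[OF N(2)])
  moreover have "{h \<in> carrier G. ?f A' h} = A'" using A' by auto
  ultimately have "of_minimal_type G A'" by simp
  then show ?thesis
    using of_minimal_type_approx approx_sym[OF AA] A by (simp add: nonempty_subsets_def)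
qed

lemma minimal_point_sim_class_iff:
  assumes "countable (carrier G)" "A \<in> nonempty_subsets G"
  shows "minimal_point (sim_classes G) (sim_class_order G) (sim_class G A) \<longleftrightarrow>
    (\<forall>B\<in>nonempty_subsets G. precsim G B A \<longrightarrow> sim G B A)"
  using assms sim_class_order_iff[OF assms] sim_class_eq_iff[OF assms(1) _ assms(2)]
  by (auto simp: minimal_point_def sim_classes_def)

end

theorem proposition9p10:
  fixes G :: "('g, 'b) monoid_scheme" (structure) and A :: "'g set"
  assumes "group G" and "countable (carrier G)" and "infinite (carrier G)"
    and "A \<subseteq> carrier G" and "A \<noteq> {}"
  shows "(of_minimal_type G A \<longleftrightarrow>
            minimal_point (sim_classes G) (sim_class_order G) (sim_class G A)) \<and>
         (of_minimal_type G A \<longleftrightarrow>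
            (\<forall>B. B \<subseteq> carrier G \<and> B \<noteq> {} \<and> precsim G B A \<longrightarrow> sim G B A))"
proof -
  interpret group G by fact
  have "of_minimal_type G A \<longleftrightarrow> (\<forall>B. B \<subseteq> carrier G \<and> B \<noteq> {} \<and> precsim G B A \<longrightarrow> sim G B A)"
    using of_minimal_type_imp_minimal[OF _ assms(2)] minimal_imp_of_minimal_type[OF assms(2,4,5)]
    by blast
  moreover have "minimal_point (sim_classes G) (sim_class_order G) (sim_class G A) \<longleftrightarrow>
      (\<forall>B. B \<subseteq> carrier G \<and> B \<noteq> {} \<and> precsim G B A \<longrightarrow> sim G B A)"
    using minimal_point_sim_class_iff[OF assms(2), of A] assms(4,5)
    by (auto simp: nonempty_subsets_def)
  ultimately show ?thesis by blast
qed

end
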